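(* Let $\mu$ be a Borel probability measure on $\mathbb{T}$ that is singular with respect to the Lebesgue measure on $\mathbb{T}$, let $\{g_n\}_{n\ge 0}$ be the Parseval frame for $L^2(\mathbb{T},\mu)$ associated to the effective sequence of monomials $\{\zeta^n\}_{n\geq 0}$, and let $\varphi$ be the inner function associated to $\mu$, namely $\varphi(z)=\frac{\psi(z)-1}{\psi(z)+1}$ with $\psi(z)=\int_{\mathbb{T}}\frac{\zeta+z}{\zeta-z}\,d\mu(\zeta)$ for $z\in\mathbb{D}$. Then for every $n\ge 0$ and for $\mu$-almost every $\zeta\in\mathbb{T}$, $$g_n(\zeta)=\lim_{\angle w\to\zeta}P_\varphi(z^n)(w).$$
   Context: $\mathbb{D}$ is the open unit disc, $\mathbb{T}$ the unit circle, $m$ the normalized Lebesgue measure on $\mathbb{T}$. $\lim_{\angle w\to\zeta}$ denotes the non-tangential limit at $\zeta\in\mathbb{T}$ (with $w\in\mathbb{D}$). $H^2=H^2(\mathbb{D})$ is the Hardy space of the disc, with norm $\|f\|_2^2=\sum_{n\ge0}|a_n|^2$ for $f(z)=\sum_{n\ge 0} a_nz^n$, identified with $H^2(\mathbb{T})\subset L^2(\mathbb{T},m)$ via non-tangential boundary values. A function $\varphi\in H^2$ is inner if its boundary values satisfy $|\varphi(\omega)|=1$ for $m$-almost every $\omega\in\mathbb{T}$. The model space is $\mathcal{H}(\varphi)=H^2\ominus\varphi H^2$ and $P_\varphi$ is the orthogonal projection onto $\mathcal{H}(\varphi)$; $P_\varphi(z^n)$ is the projection of the monomial $z\mapsto z^n$,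 regarded as a holomorphic function on $\mathbb{D}$. For $\mu$ a singular probability measure, the function $\varphi=(\psi-1)/(\psi+1)$ of the claim is inner and satisfies $\varphi(0)=0$. A complete sequence of unit vectors $\{\varphi_n\}_{n\ge0}$ in a Hilbert space is effective if for every vector $\xi$ the Kaczmarz iterates $\xi_0=\langle\xi,\varphi_0\rangle\varphi_0$, $\xi_n=\xi_{n-1}+\langle\xi-\xi_{n-1},\varphi_n\rangle\varphi_n$ converge in norm to $\xi$. The associated sequence $\{\gamma_n\}$ is defined by $\gamma_0=\varphi_0$, $\gamma_n=\varphi_n-\sum_{k=0}^{n-1}\langle\varphi_n,\varphi_k\rangle\gamma_k$ (inner products linear in the first variable); it satisfies $\xi_n=\sum_{k=0}^n\langle\xi,\gamma_k\rangle\varphi_k$, and $\{\varphi_n\}$ is effective iff $\{\gamma_n\}$ is a Parseval frame. For $\mu$ a singular probability measure the monomials $\{\zeta^n\}_{n\ge0}$ are effective in $L^2(\mathbb{T},\mu)$, and $\{g_n\}_{n\ge0}$ denotes the sequence $\{\gamma_n\}$ obtained from $\varphi_n=\zeta^n$, i.e. $g_0=1$ and $g_n=\zeta^n-\sum_{k=0}^{n-1}\langle\zeta^n,\zeta^k\rangle_{L^2(\mathbb{T},\mu)}\,g_k$. *)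

theory Defs
  imports "HOL-Probability.Probability" "HOL-Complex_Analysis.Complex_Analysis"
begin

section \<open>Measures on the unit circle\<close>

abbreviation circle_borel :: "complex measure" where
  "circle_borel \<equiv> restrict_space borel (sphere 0 1)"

definition circle_lebesgue :: "complex measure" where
  "circle_lebesgue = distr (uniform_measure lborel {0..<2*pi}) circle_borel cis"

lemma measurable_cis_circle: "cis \<in> borel \<rightarrow>\<^sub>M circle_borel"
  by (intro measurable_restrict_space2 borel_measurable_continuous_onI continuous_intros) auto

lemma prob_space_circle_lebesgue: "prob_space circle_lebesgue"
proof -
  have "prob_space (uniform_measure lborel {0..<2*pi})"
    by (rule prob_space_uniform_measure) (use pi_gt_zero in \<open>auto simp: ennreal_eq_0_iff not_le[symmetric] simp del: pi_gt_zero\<close>)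
  then show ?thesis
    unfolding circle_lebesgue_def
    by (rule prob_space.prob_space_distr) (use measurable_cis_circle in simp)
qed

definition mutually_singular :: "'a measure \<Rightarrow> 'a measure \<Rightarrow> bool" where
  "mutually_singular M N \<longleftrightarrow>
     (\<exists>A \<in> sets M \<inter> sets N. emeasure M A = 0 \<and> emeasure N (space N - A) = 0)"

section \<open>The sequence associated to a sequence in \<open>L\<^sup>2\<close>\<close>

definition l2_inner :: "'a measure \<Rightarrow> ('a \<Rightarrow> complex) \<Rightarrow> ('a \<Rightarrow> complex) \<Rightarrow> complex" where
  "l2_inner M f g = (LINT x|M. f x * cnj (g x))"

text \<open>
  For a sequence of vectors given by representatives \<open>\<phi> n\<close>, this is the sequence
  \<open>\<gamma>\<^sub>n = \<phi>\<^sub>n - (\<Sum>k<n. \<langle>\<phi>\<^sub>n, \<phi>\<^sub>k\<rangle> \<gamma>\<^sub>k)\<close> of the Kaczmarz algorithm, so that the iterates for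
  a vector \<open>\<xi>\<close> are \<open>\<xi>\<^sub>n = (\<Sum>k\<le>n. \<langle>\<xi>, \<gamma>\<^sub>k\<rangle> \<phi>\<^sub>k)\<close>. It is given by representatives as well.
\<close>

fun kaczmarz_dual :: "'a measure \<Rightarrow> (nat \<Rightarrow> 'a \<Rightarrow> complex) \<Rightarrow> nat \<Rightarrow> 'a \<Rightarrow> complex" where
  "kaczmarz_dual M \<phi> n x =
     \<phi> n x - (\<Sum>k<n. l2_inner M (\<phi> n) (\<phi> k) * kaczmarz_dual M \<phi> k x)"

declare kaczmarz_dual.simps [simp del]

section \<open>Hardy space and model spaces\<close>

text \<open>
  Holomorphic functions on the disc are represented by functions on the whole plane, whose
  values off the open disc are irrelevant.
\<close>

definition hardy2 :: "(complex \<Rightarrow> complex) set" where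
  "hardy2 = {f. f holomorphic_on ball 0 1 \<and>
                summable (\<lambda>n. (cmod (fps_nth (fps_expansion f 0) n))\<^sup>2)}"

definition hardy2_inner :: "(complex \<Rightarrow> complex) \<Rightarrow> (complex \<Rightarrow> complex) \<Rightarrow> complex" where
  "hardy2_inner f g =
     (\<Sum>n. fps_nth (fps_expansion f 0) n * cnj (fps_nth (fps_expansion g 0) n))"

text \<open>
  \<open>H\<^sup>2 \<ominus> \<phi> H\<^sup>2\<close>; only meaningful when \<open>\<phi> H\<^sup>2 \<subseteq> H\<^sup>2\<close>, in particular for inner \<open>\<phi>\<close>.
\<close>

definition model_space :: "(complex \<Rightarrow> complex) \<Rightarrow> (complex \<Rightarrow> complex) set" where
  "model_space \<phi> = {f \<in> hardy2. \<forall>h\<in>hardy2. hardy2_inner f (\<lambda>z. \<phi> z * h z) = 0}"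

text \<open>
  The last conjunct normalises the irrelevant values off the disc, so that the projection is
  unique as a function on the plane.
\<close>

definition model_proj :: "(complex \<Rightarrow> complex) \<Rightarrow> (complex \<Rightarrow> complex) \<Rightarrow> complex \<Rightarrow> complex" where
  "model_proj \<phi> f = (THE p. p \<in> model_space \<phi> \<and>
     (\<forall>h\<in>model_space \<phi>. hardy2_inner (\<lambda>z. f z - p z) h = 0) \<and>
     (\<forall>z. z \<notin> ball 0 1 \<longrightarrow> p z = 0))"

section \<open>The inner function of a measure\<close>

definition herglotz :: "complex measure \<Rightarrow> complex \<Rightarrow> complex" where
  "herglotz \<mu> z = (LINT \<zeta>|\<mu>. (\<zeta> + z) / (\<zeta> - z))"

definition inner_fun_of :: "complex measure \<Rightarrow> complex \<Rightarrow> complex" where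
  "inner_fun_of \<mu> z = (herglotz \<mu> z - 1) / (herglotz \<mu> z + 1)"

section \<open>Non-tangential limits\<close>

definition stolz_region :: "complex \<Rightarrow> real \<Rightarrow> complex set" where
  "stolz_region \<zeta> \<alpha> = {w \<in> ball 0 1. cmod (\<zeta> - w) < \<alpha> * (1 - cmod w)}"

text \<open>Apertures \<open>\<alpha> \<le> 1\<close> are left out because their regions are empty for \<open>\<zeta>\<close> on the circle.\<close>

definition has_nt_limit :: "(complex \<Rightarrow> complex) \<Rightarrow> complex \<Rightarrow> complex \<Rightarrow> bool" where
  "has_nt_limit f \<zeta> l \<longleftrightarrow> (\<forall>\<alpha>>1. (f \<longlongrightarrow> l) (at \<zeta> within stolz_region \<zeta> \<alpha>))"

end

theory Submission
  imports Defs
begin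

text \<open>
  Write \<open>\<phi>\<close> for the function associated to \<open>\<mu>\<close>, with Taylor coefficients \<open>\<phi>\<^sub>j\<close>, and \<open>\<psi>\<close> for the
  Herglotz transform of \<open>\<mu>\<close>. Both sides of the claim come from the one polynomial
  \<open>q\<^sub>n(z) = (\<Sum>k\<le>n. cnj \<phi>\<^bsub>n-k\<^esub> * z ^ k)\<close>: on the disc the projection of \<open>z ^ n\<close> is
  \<open>w ^ n - \<phi> w * q\<^sub>n w\<close>, on the circle the Kaczmarz function is \<open>\<zeta> ^ n - q\<^sub>n \<zeta>\<close>. So all that
  remains is that \<open>\<phi>\<close> has the non-tangential limit 1 at \<open>\<mu>\<close>-almost every point.
  
  The formula for the projection (\<open>model_proj_power\<close>) expresses that the projection is
  \<open>f - \<phi> P\<^sub>+(cnj \<phi> f)\<close>, which rests on multiplication by \<open>\<phi>\<close> being an isometry of \<open>H\<^sup>2\<close>. As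
  \<open>\<bar>\<phi>\<bar> \<le> 1\<close>, it is a contraction (\<open>hardy2_mult_contraction\<close>), and a contraction that preserves
  the norm of one vector preserves all inner products with that vector
  (\<open>hardy2_inner_mult_inner_isometry\<close>). Monomials only shift coefficients, so a single number is
  decisive, the \<open>H\<^sup>2\<close> norm of \<open>\<phi>\<close>. It is 1 because \<open>\<mu>\<close> is singular (\<open>inner_fun_of_norm\<close>):
  \<open>1 - \<bar>\<phi>\<bar>\<^sup>2\<close> is at most \<open>min 1 (4 Re \<psi>)\<close>, where \<open>Re \<psi>\<close> is the Poisson integral of \<open>\<mu>\<close>, and up
  to an arbitrarily small part \<open>\<mu>\<close> lives on a compact Lebesgue null set, off which the Poisson
  integral tends to 0.
  
  The formula for the Kaczmarz sequence (\<open>kaczmarz_dual_monomials\<close>) is an identity of formal power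
  series: the recursion says that the generating function of the sequence is that of the monomials
  divided by the moment series of \<open>\<mu>\<close>, and \<open>1 - \<phi> = 2 / (\<psi> + 1)\<close> is the reciprocal of the
  conjugated moment series.
  
  For the boundary values, \<open>1 - \<phi> = 2 / (\<psi> + 1)\<close> reduces the limit to the divergence of
  \<open>Re \<psi>\<close>, and inside a Stolz region \<open>Re \<psi> w\<close> dominates the mean density of \<open>\<mu>\<close> on the ball around
  \<open>\<zeta>\<close> of radius \<open>1 - \<bar>w\<bar>\<close> (\<open>Re_herglotz_stolz_ge\<close>). By a Vitali covering argument a measure
  carried by a Lebesgue null set has infinite density at almost every one of its points
  (\<open>singular_measure_density_infinite\<close>).
\<close>

section \<open>Power series on the unit disc\<close>

abbreviation taylor_coeff :: "(complex \<Rightarrow> complex) \<Rightarrow> nat \<Rightarrow> complex" where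
  "taylor_coeff f n \<equiv> fps_nth (fps_expansion f 0) n"

lemma has_fps_expansion_disc:
  "f holomorphic_on ball 0 1 \<Longrightarrow> f has_fps_expansion fps_expansion f 0"
  by (rule has_fps_expansion_fps_expansion[of "ball 0 1"]) auto

lemma taylor_sums:
  assumes "f holomorphic_on ball 0 1" "cmod z < 1"
  shows "(\<lambda>n. taylor_coeff f n * z ^ n) sums f z"
  by (rule has_fps_expansion_imp_sums_complex[where r = "ereal 1"])
     (use assms in \<open>auto intro: has_fps_expansion_disc\<close>)

lemma taylor_abs_summable:
  assumes "f holomorphic_on ball 0 1" "cmod z < 1"
  shows "summable (\<lambda>n. cmod (taylor_coeff f n * z ^ n))"
proof -
  obtain r where r: "cmod z < r" "r < 1" using assms(2) dense by blast
  have "summable (\<lambda>n. taylor_coeff f n * (complex_of_real r) ^ n)"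
    using taylor_sums[OF assms(1), of "complex_of_real r"] r norm_ge_zero[of z] by (auto simp: sums_iff)
  then show ?thesis
    by (rule powser_insidea) (use r norm_ge_zero[of z] in auto)
qed

lemma taylor_coeff_eqI:
  assumes "\<And>z. cmod z < 1 \<Longrightarrow> (\<lambda>n. a n * z ^ n) sums f z"
  shows "f holomorphic_on ball 0 1" "taylor_coeff f n = a n"
proof -
  show "f holomorphic_on ball 0 1"
    by (rule power_series_holomorphic[where a = a]) (use assms in \<open>auto simp: dist_norm\<close>)
  have "f has_fps_expansion Abs_fps a"
  proof (rule has_fps_expansionI)
    have "\<forall>\<^sub>F u in nhds 0. u \<in> ball (0::complex) 1"
      by (rule eventually_nhds_in_open) auto
    then show "\<forall>\<^sub>F u in nhds 0. (\<lambda>n. fps_nth (Abs_fps a) n * u ^ n) sums f u"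
      by eventually_elim (use assms in auto)
  qed
  then show "taylor_coeff f n = a n"
    by (simp add: fps_expansion_eqI)
qed

lemma fps_expansion_disc_cong:
  assumes "\<And>z. cmod z < 1 \<Longrightarrow> f z = g z"
  shows "fps_expansion f 0 = fps_expansion g 0"
proof (rule fps_expansion_cong)
  have "\<forall>\<^sub>F u in nhds 0. u \<in> ball (0::complex) 1"
    by (rule eventually_nhds_in_open) auto
  then show "\<forall>\<^sub>F w in nhds 0. f w = g w"
    by eventually_elim (use assms in auto)
qed

lemma fps_expansion_disc_mult:
  assumes "f holomorphic_on ball 0 1" "g holomorphic_on ball 0 1"
  shows "fps_expansion (\<lambda>z. f z * g z) 0 = fps_expansion f 0 * fps_expansion g 0"
  by (intro fps_expansion_eqI has_fps_expansion_mult has_fps_expansion_disc assms)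

lemma fps_expansion_disc_add:
  assumes "f holomorphic_on ball 0 1" "g holomorphic_on ball 0 1"
  shows "fps_expansion (\<lambda>z. f z + g z) 0 = fps_expansion f 0 + fps_expansion g 0"
  by (intro fps_expansion_eqI has_fps_expansion_add has_fps_expansion_disc assms)

lemma fps_expansion_disc_diff:
  assumes "f holomorphic_on ball 0 1" "g holomorphic_on ball 0 1"
  shows "fps_expansion (\<lambda>z. f z - g z) 0 = fps_expansion f 0 - fps_expansion g 0"
  by (intro fps_expansion_eqI has_fps_expansion_diff has_fps_expansion_disc assms)

lemma fps_expansion_disc_cmult:
  assumes "f holomorphic_on ball 0 1"
  shows "fps_expansion (\<lambda>z. c * f z) 0 = fps_const c * fps_expansion f 0"
  by (intro fps_expansion_eqI has_fps_expansion_cmult_left has_fps_expansion_disc assms)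

lemma fps_expansion_disc_power: "fps_expansion (\<lambda>z. z ^ n) 0 = fps_X ^ n"
  by (intro fps_expansion_eqI has_fps_expansion_fps_X_power)

lemma hardy2_holomorphic: "f \<in> hardy2 \<Longrightarrow> f holomorphic_on ball 0 1"
  by (simp add: hardy2_def)

section \<open>Fourier analysis on the unit circle\<close>

lemma unit_cnj_mult: "cmod \<zeta> = 1 \<Longrightarrow> \<zeta> * cnj \<zeta> = 1"
  by (simp add: complex_norm_square[symmetric])

lemma circle_measurable_continuous:
  assumes "continuous_on (sphere 0 1) f"
  shows "f \<in> borel_measurable circle_borel"
  using assms by (rule borel_measurable_continuous_on_restrict)

text \<open>
  The closed interval, in place of the half-open one of the definition, is the form that the
  fundamental theorem of calculus accepts; the additional end point has measure 0.
\<close>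

lemma integral_circle_lebesgue:
  fixes f :: "complex \<Rightarrow> complex"
  assumes "f \<in> borel_measurable circle_borel"
  shows "(LINT \<zeta>|circle_lebesgue. f \<zeta>) = (LINT \<theta>|lborel. indicator {0..2*pi} \<theta> *\<^sub>R f (cis \<theta>)) /\<^sub>R (2*pi)"
proof -
  have m: "(\<lambda>\<theta>. f (cis \<theta>)) \<in> borel_measurable borel"
    using measurable_comp[OF measurable_cis_circle assms] by (simp add: comp_def)
  have u: "uniform_measure lborel {0..<2*pi} = density lborel (\<lambda>x. ennreal (indicator {0..<2*pi} x / (2*pi)))"
    unfolding uniform_measure_def
    by (rule arg_cong2[where f = density], simp)
       (auto simp: fun_eq_iff divide_ennreal ennreal_1[symmetric] simp del: ennreal_1 split: split_indicator)
  have "(LINT \<zeta>|circle_lebesgue. f \<zeta>) = (LINT \<theta>|uniform_measure lborel {0..<2*pi}. f (cis \<theta>))"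
    unfolding circle_lebesgue_def
    by (rule integral_distr) (use measurable_cis_circle assms in auto)
  also have "\<dots> = (LINT \<theta>|lborel. (indicator {0..<2*pi} \<theta> / (2*pi)) *\<^sub>R f (cis \<theta>))"
    unfolding u by (rule integral_density) (use m in auto)
  also have "\<dots> = (LINT \<theta>|lborel. (indicator {0..2*pi} \<theta> / (2*pi)) *\<^sub>R f (cis \<theta>))"
  proof (rule integral_cong_AE)
    show "AE x in lborel. (indicator {0..<2*pi} x / (2*pi)) *\<^sub>R f (cis x) =
             (indicator {0..2*pi} x / (2*pi)) *\<^sub>R f (cis x)"
      using AE_lborel_singleton[of "2*pi"] by eventually_elim (auto split: split_indicator)
  qed (use m in auto)
  also have "\<dots> = (LINT \<theta>|lborel. inverse (2*pi) *\<^sub>R (indicator {0..2*pi} \<theta> *\<^sub>R f (cis \<theta>)))"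
    unfolding scaleR_scaleR divide_inverse mult.commute[of "inverse (2*pi)"] ..
  also have "\<dots> = (LINT \<theta>|lborel. indicator {0..2*pi} \<theta> *\<^sub>R f (cis \<theta>)) /\<^sub>R (2*pi)"
    by (rule integral_scaleR_right)
  finally show ?thesis .
qed

lemma integral_circle_power:
  assumes "n > 0"
  shows "(LINT \<zeta>|circle_lebesgue. \<zeta> ^ n) = 0"
proof -
  have "(LINT \<theta>|lborel. indicator {0..2*pi} \<theta> *\<^sub>R cis \<theta> ^ n) =
     cis (2*pi) ^ n / (\<i> * of_nat n) - cis 0 ^ n / (\<i> * of_nat n)"
  proof (rule integral_FTC_atLeastAtMost)
    fix x :: real
    have "((\<lambda>z. exp (\<i> * of_nat n * z) / (\<i> * of_nat n)) has_field_derivative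
             exp (\<i> * of_nat n * complex_of_real x)) (at (complex_of_real x))"
      using assms by (auto intro!: derivative_eq_intros)
    from has_vector_derivative_real_field[OF this, of "{0..2*pi}"]
    show "((\<lambda>x. cis x ^ n / (\<i> * of_nat n)) has_vector_derivative cis x ^ n) (at x within {0..2*pi})"
      unfolding Complex.DeMoivre unfolding cis_conv_exp of_real_mult of_real_of_nat_eq mult.assoc .
  qed (auto intro!: continuous_intros)
  then show ?thesis
    by (subst integral_circle_lebesgue) (auto intro!: circle_measurable_continuous continuous_intros)
qed

lemma space_circle_lebesgue [simp]: "space circle_lebesgue = sphere 0 1"
  by (simp add: circle_lebesgue_def space_restrict_space)

lemma sets_circle_lebesgue [simp, measurable_cong]: "sets circle_lebesgue = sets circle_borel"
  by (simp add: circle_lebesgue_def)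

lemma integral_circle_orthonormal:
  "(LINT \<zeta>|circle_lebesgue. \<zeta> ^ j * cnj (\<zeta> ^ k)) = (if j = k then 1 else 0)"
proof -
  interpret prob_space circle_lebesgue by (rule prob_space_circle_lebesgue)
  have *: "(LINT \<zeta>|circle_lebesgue. \<zeta> ^ (d + k) * cnj (\<zeta> ^ k)) = (if d = 0 then 1 else 0)" for d k
  proof -
    have "(LINT \<zeta>|circle_lebesgue. \<zeta> ^ (d + k) * cnj (\<zeta> ^ k)) = (LINT \<zeta>|circle_lebesgue. \<zeta> ^ d)"
    proof (rule Bochner_Integration.integral_cong[OF refl])
      fix \<zeta> assume "\<zeta> \<in> space circle_lebesgue"
      then have "\<zeta> ^ k * cnj \<zeta> ^ k = 1"
        using unit_cnj_mult[of \<zeta>] by (simp flip: power_mult_distrib)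
      then show "\<zeta> ^ (d + k) * cnj (\<zeta> ^ k) = \<zeta> ^ d"
        by (simp add: power_add mult.assoc)
    qed
    then show ?thesis
      using integral_circle_power[of d] prob_space by (cases "d = 0") auto
  qed
  show ?thesis
  proof (cases "k \<le> j")
    case True
    then show ?thesis using *[of "j - k" k] by auto
  next
    case False
    have "(LINT \<zeta>|circle_lebesgue. \<zeta> ^ j * cnj (\<zeta> ^ k)) = (LINT \<zeta>|circle_lebesgue. cnj (\<zeta> ^ k * cnj (\<zeta> ^ j)))"
      by (simp add: mult.commute)
    also have "\<dots> = cnj (LINT \<zeta>|circle_lebesgue. \<zeta> ^ k * cnj (\<zeta> ^ j))"
      by (rule Bochner_Integration.integral_cnj)
    finally show ?thesis using *[of "k - j" j] False by auto
  qed
qed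

lemma holomorphic_disc_bounded:
  assumes "f holomorphic_on ball 0 1" "r < 1"
  shows "\<exists>B. \<forall>z. cmod z \<le> r \<longrightarrow> cmod (f z) \<le> B"
proof -
  have "bounded (f ` cball 0 r)"
    by (intro compact_imp_bounded compact_continuous_image
         holomorphic_on_imp_continuous_on[OF holomorphic_on_subset[OF assms(1)]]) (use assms in auto)
  then obtain B where "\<forall>x\<in>f ` cball 0 r. cmod x \<le> B"
    unfolding bounded_iff by blast
  then show ?thesis by (intro exI[of _ B]) auto
qed

lemma circle_dilation_measurable:
  assumes "f holomorphic_on ball 0 1" "0 \<le> r" "r < 1"
  shows "(\<lambda>\<zeta>. f (complex_of_real r * \<zeta>)) \<in> borel_measurable circle_borel"
proof (rule circle_measurable_continuous)
  have "continuous_on (ball 0 1) f"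
    using assms(1) by (rule holomorphic_on_imp_continuous_on)
  then show "continuous_on (sphere 0 1) (\<lambda>\<zeta>. f (complex_of_real r * \<zeta>))"
    by (rule continuous_on_compose2) (use assms in \<open>auto intro!: continuous_intros simp: norm_mult\<close>)
qed

text \<open>
  Inside the disc the power series converges absolutely and uniformly on circles, so it may be
  integrated term by term, and orthonormality of the monomials isolates one coefficient. The case
  \<open>k = 0\<close> is the mean value property.
\<close>

lemma integral_circle_dilation_coeff:
  assumes f: "f holomorphic_on ball 0 1" and r: "0 \<le> r" "r < 1"
  shows "(LINT \<zeta>|circle_lebesgue. f (complex_of_real r * \<zeta>) * cnj (\<zeta> ^ k)) = taylor_coeff f k * complex_of_real r ^ k"
proof -
  interpret prob_space circle_lebesgue by (rule prob_space_circle_lebesgue)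
  let ?b = "\<lambda>n. taylor_coeff f n * complex_of_real r ^ n"
  have sb: "summable (\<lambda>n. cmod (?b n))"
    by (rule taylor_abs_summable[OF f]) (use r in auto)
  have nrm: "cmod (?b n * (\<zeta> ^ n * cnj (\<zeta> ^ k))) = cmod (?b n)" if "\<zeta> \<in> space circle_lebesgue" for \<zeta> n
    using that by (simp add: norm_mult norm_power)
  have int: "integrable circle_lebesgue (\<lambda>\<zeta>. ?b n * (\<zeta> ^ n * cnj (\<zeta> ^ k)))" for n
    by (rule integrable_const_bound[where B = "cmod (?b n)"])
       (auto simp: nrm measurable_cong_sets[OF sets_circle_lebesgue refl]
             simp del: complex_cnj_power intro!: circle_measurable_continuous continuous_intros)
  have "(\<lambda>n. LINT \<zeta>|circle_lebesgue. ?b n * (\<zeta> ^ n * cnj (\<zeta> ^ k))) sums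
        (LINT \<zeta>|circle_lebesgue. (\<Sum>n. ?b n * (\<zeta> ^ n * cnj (\<zeta> ^ k))))"
  proof (rule sums_integral[OF int])
    show "AE \<zeta> in circle_lebesgue. summable (\<lambda>n. norm (?b n * (\<zeta> ^ n * cnj (\<zeta> ^ k))))"
      using sb by (intro AE_I2) (simp only: nrm)
    have "(\<lambda>n. LINT \<zeta>|circle_lebesgue. norm (?b n * (\<zeta> ^ n * cnj (\<zeta> ^ k)))) = (\<lambda>n. cmod (?b n))"
      by (rule ext, subst Bochner_Integration.integral_cong[OF refl nrm], assumption) (simp add: prob_space[simplified])
    then show "summable (\<lambda>n. LINT \<zeta>|circle_lebesgue. norm (?b n * (\<zeta> ^ n * cnj (\<zeta> ^ k))))"
      using sb by simp
  qed
  also have "(\<lambda>n. LINT \<zeta>|circle_lebesgue. ?b n * (\<zeta> ^ n * cnj (\<zeta> ^ k))) = (\<lambda>n. if n = k then ?b k else 0)"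
    by (simp add: integral_circle_orthonormal fun_eq_iff del: complex_cnj_power)
  also have "(LINT \<zeta>|circle_lebesgue. (\<Sum>n. ?b n * (\<zeta> ^ n * cnj (\<zeta> ^ k)))) =
      (LINT \<zeta>|circle_lebesgue. f (complex_of_real r * \<zeta>) * cnj (\<zeta> ^ k))"
  proof (rule Bochner_Integration.integral_cong[OF refl])
    fix \<zeta> assume "\<zeta> \<in> space circle_lebesgue"
    then have "cmod (complex_of_real r * \<zeta>) < 1" using r by (simp add: norm_mult)
    from sums_mult2[OF taylor_sums[OF f this], of "cnj (\<zeta> ^ k)"]
    show "(\<Sum>n. ?b n * (\<zeta> ^ n * cnj (\<zeta> ^ k))) = f (complex_of_real r * \<zeta>) * cnj (\<zeta> ^ k)"
      by (simp add: sums_iff power_mult_distrib mult_ac)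
  qed
  finally show ?thesis
    using sums_single[of k "\<lambda>_. ?b k"] sums_unique2 by fastforce
qed

text \<open>
  Only the conjugated factor of \<open>\<bar>f\<bar>\<^sup>2 = f * cnj f\<close> is expanded into its power series; the
  previous lemma then evaluates each term.
\<close>

lemma parseval_circle:
  assumes f: "f holomorphic_on ball 0 1" and r: "0 \<le> r" "r < 1"
  shows "(\<lambda>n. (cmod (taylor_coeff f n) * r ^ n)\<^sup>2) sums
           (LINT \<zeta>|circle_lebesgue. (cmod (f (complex_of_real r * \<zeta>)))\<^sup>2)"
proof -
  interpret prob_space circle_lebesgue by (rule prob_space_circle_lebesgue)
  let ?b = "\<lambda>n. taylor_coeff f n * complex_of_real r ^ n"
  let ?g = "\<lambda>\<zeta>. f (complex_of_real r * \<zeta>)"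
  have sb: "summable (\<lambda>n. cmod (?b n))"
    by (rule taylor_abs_summable[OF f]) (use r in auto)
  obtain B where B: "\<And>z. cmod z \<le> r \<Longrightarrow> cmod (f z) \<le> B"
    using holomorphic_disc_bounded[OF f r(2)] by blast
  have B': "cmod (?g \<zeta>) \<le> B" if "\<zeta> \<in> space circle_lebesgue" for \<zeta>
    using that r by (intro B) (simp add: norm_mult)
  have meas [measurable]: "?g \<in> borel_measurable circle_lebesgue"
    using circle_dilation_measurable[OF f r] by (simp add: measurable_cong_sets[OF sets_circle_lebesgue refl])
  have meas2 [measurable]: "(\<lambda>\<zeta>. cnj (\<zeta> ^ n)) \<in> borel_measurable circle_lebesgue" for n
    unfolding measurable_cong_sets[OF sets_circle_lebesgue refl]
    by (intro circle_measurable_continuous continuous_intros)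
  have nrm: "cmod (cnj (?b n) * (?g \<zeta> * cnj (\<zeta> ^ n))) = cmod (?b n) * cmod (?g \<zeta>)"
    if "\<zeta> \<in> space circle_lebesgue" for \<zeta> n
    using that by (simp add: norm_mult norm_power del: complex_cnj_mult complex_cnj_power)
  have le: "cmod (cnj (?b n) * (?g \<zeta> * cnj (\<zeta> ^ n))) \<le> cmod (?b n) * B"
    if "\<zeta> \<in> space circle_lebesgue" for \<zeta> n
    unfolding nrm[OF that] by (rule mult_left_mono[OF B'[OF that] norm_ge_zero])
  have int: "integrable circle_lebesgue (\<lambda>\<zeta>. cnj (?b n) * (?g \<zeta> * cnj (\<zeta> ^ n)))" for n
  proof (rule integrable_const_bound[where B = "cmod (?b n) * B"])
    show "AE \<zeta> in circle_lebesgue. cmod (cnj (?b n) * (?g \<zeta> * cnj (\<zeta> ^ n))) \<le> cmod (?b n) * B"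
      using le by (rule AE_I2)
    show "(\<lambda>\<zeta>. cnj (?b n) * (?g \<zeta> * cnj (\<zeta> ^ n))) \<in> borel_measurable circle_lebesgue"
      by (intro borel_measurable_times borel_measurable_const meas meas2)
  qed
  have "(\<lambda>n. LINT \<zeta>|circle_lebesgue. cnj (?b n) * (?g \<zeta> * cnj (\<zeta> ^ n))) sums
        (LINT \<zeta>|circle_lebesgue. (\<Sum>n. cnj (?b n) * (?g \<zeta> * cnj (\<zeta> ^ n))))"
  proof (rule sums_integral[OF int])
    show "AE \<zeta> in circle_lebesgue. summable (\<lambda>n. norm (cnj (?b n) * (?g \<zeta> * cnj (\<zeta> ^ n))))"
    proof (rule AE_I2)
      fix \<zeta> assume z: "\<zeta> \<in> space circle_lebesgue"
      show "summable (\<lambda>n. norm (cnj (?b n) * (?g \<zeta> * cnj (\<zeta> ^ n))))"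
        unfolding nrm[OF z] by (rule summable_mult2[OF sb])
    qed
    show "summable (\<lambda>n. LINT \<zeta>|circle_lebesgue. norm (cnj (?b n) * (?g \<zeta> * cnj (\<zeta> ^ n))))"
    proof (rule summable_comparison_test')
      show "summable (\<lambda>n. cmod (?b n) * B)" by (rule summable_mult2[OF sb])
      show "norm (LINT \<zeta>|circle_lebesgue. norm (cnj (?b n) * (?g \<zeta> * cnj (\<zeta> ^ n)))) \<le> cmod (?b n) * B" for n
      proof -
        have "(LINT \<zeta>|circle_lebesgue. norm (cnj (?b n) * (?g \<zeta> * cnj (\<zeta> ^ n)))) \<le> (LINT \<zeta>|circle_lebesgue. cmod (?b n) * B)"
          by (rule integral_mono[OF integrable_norm[OF int] _ le]) auto
        also have "\<dots> = cmod (?b n) * B"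
          using prob_space by simp
        finally show ?thesis by simp
      qed
    qed
  qed
  also have "(\<lambda>n. LINT \<zeta>|circle_lebesgue. cnj (?b n) * (?g \<zeta> * cnj (\<zeta> ^ n))) =
      (\<lambda>n. complex_of_real ((cmod (taylor_coeff f n) * r ^ n)\<^sup>2))"
  proof (rule ext)
    fix n
    have "(LINT \<zeta>|circle_lebesgue. cnj (?b n) * (?g \<zeta> * cnj (\<zeta> ^ n))) = cnj (?b n) * ?b n"
      unfolding integral_mult_right_zero integral_circle_dilation_coeff[OF f r] ..
    also have "\<dots> = complex_of_real ((cmod (?b n))\<^sup>2)"
      unfolding complex_norm_square by (rule mult.commute)
    also have "cmod (?b n) = cmod (taylor_coeff f n) * r ^ n"
      using r by (simp add: norm_mult norm_power)
    finally show "(LINT \<zeta>|circle_lebesgue. cnj (?b n) * (?g \<zeta> * cnj (\<zeta> ^ n))) =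
        complex_of_real ((cmod (taylor_coeff f n) * r ^ n)\<^sup>2)" .
  qed
  also have "(LINT \<zeta>|circle_lebesgue. (\<Sum>n. cnj (?b n) * (?g \<zeta> * cnj (\<zeta> ^ n)))) =
      (LINT \<zeta>|circle_lebesgue. complex_of_real ((cmod (?g \<zeta>))\<^sup>2))"
  proof (rule Bochner_Integration.integral_cong[OF refl])
    fix \<zeta> assume "\<zeta> \<in> space circle_lebesgue"
    then have "cmod (complex_of_real r * \<zeta>) < 1" using r by (simp add: norm_mult)
    from sums_mult2[OF sums_cnj[THEN iffD2, OF taylor_sums[OF f this]], of "?g \<zeta>"]
    have "(\<lambda>n. cnj (?b n) * (?g \<zeta> * cnj (\<zeta> ^ n))) sums (cnj (?g \<zeta>) * ?g \<zeta>)"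
      by (simp add: power_mult_distrib mult_ac)
    then show "(\<Sum>n. cnj (?b n) * (?g \<zeta> * cnj (\<zeta> ^ n))) = complex_of_real ((cmod (?g \<zeta>))\<^sup>2)"
      unfolding complex_norm_square by (simp add: sums_iff mult.commute)
  qed
  finally show ?thesis
    unfolding integral_complex_of_real sums_of_real_iff .
qed

text \<open>
  Passes bounds on circles of radius \<open>r < 1\<close> to the boundary. The partial sums are continuous in \<open>r\<close>
  and, by positivity, lie below the Abel sums.
\<close>

lemma summable_of_bounded_abel_sums:
  fixes a :: "nat \<Rightarrow> real"
  assumes "\<And>n. 0 \<le> a n" and "\<And>r. 0 \<le> r \<Longrightarrow> r < 1 \<Longrightarrow> summable (\<lambda>n. a n * r ^ n) \<and> (\<Sum>n. a n * r ^ n) \<le> B"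
  shows "summable a \<and> suminf a \<le> B"
proof -
  have p: "(\<Sum>n<N. a n) \<le> B" for N
  proof (rule tendsto_upperbound)
    show "((\<lambda>r. \<Sum>n<N. a n * r ^ n) \<longlongrightarrow> (\<Sum>n<N. a n)) (at_left (1::real))"
      by (auto intro!: tendsto_eq_intros)
    have "eventually (\<lambda>r::real. r \<in> {0<..<1}) (at_left 1)"
      by (rule eventually_at_leftI[of 0]) auto
    then show "eventually (\<lambda>r. (\<Sum>n<N. a n * r ^ n) \<le> B) (at_left (1::real))"
    proof eventually_elim
      case (elim r)
      then have "(\<Sum>n<N. a n * r ^ n) \<le> (\<Sum>n. a n * r ^ n)"
        using assms by (intro sum_le_suminf) auto
      also have "\<dots> \<le> B" using assms(2)[of r] elim by auto
      finally show ?case .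
    qed
  qed auto
  have "summable a"
    by (rule summableI_nonneg_bounded[OF assms(1) p])
  then show ?thesis
    using suminf_le_const[OF _ p] by simp
qed

section \<open>The Hardy space and multiplication by bounded functions\<close>

definition hardy2_norm_sq :: "(complex \<Rightarrow> complex) \<Rightarrow> real" where
  "hardy2_norm_sq f = (\<Sum>n. (cmod (taylor_coeff f n))\<^sup>2)"

text \<open>
  On each circle of radius \<open>r < 1\<close> the mean of \<open>\<bar>u h\<bar>\<^sup>2\<close> is at most that of \<open>\<bar>h\<bar>\<^sup>2\<close>, and Parseval's
  identity turns these means into weighted sums of squared coefficients.
\<close>

lemma hardy2_mult_contraction:
  assumes u: "u holomorphic_on ball 0 1" "\<forall>z. cmod z < 1 \<longrightarrow> cmod (u z) \<le> 1"
    and h: "h \<in> hardy2"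
  shows "(\<lambda>z. u z * h z) \<in> hardy2" "hardy2_norm_sq (\<lambda>z. u z * h z) \<le> hardy2_norm_sq h"
proof -
  note hh = hardy2_holomorphic[OF h]
  have uh: "(\<lambda>z. u z * h z) holomorphic_on ball 0 1"
    by (intro holomorphic_intros u hh)
  interpret prob_space circle_lebesgue by (rule prob_space_circle_lebesgue)
  have sh: "summable (\<lambda>n. (cmod (taylor_coeff h n))\<^sup>2)"
    using h by (simp add: hardy2_def)
  let ?a = "\<lambda>n. (cmod (taylor_coeff (\<lambda>z. u z * h z) n))\<^sup>2"
  have *: "summable (\<lambda>n. ?a n * (r\<^sup>2) ^ n) \<and> (\<Sum>n. ?a n * (r\<^sup>2) ^ n) \<le> hardy2_norm_sq h" if r: "0 \<le> r" "r < 1" for r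
  proof -
    have e: "(x * r ^ n)\<^sup>2 = x\<^sup>2 * (r\<^sup>2) ^ n" for x n
      by (simp add: power_mult_distrib flip: power_mult) (simp add: mult.commute)
    note P = parseval_circle[OF uh r, unfolded e] and Q = parseval_circle[OF hh r, unfolded e]
    have intg: "integrable circle_lebesgue (\<lambda>\<zeta>. (cmod (f (complex_of_real r * \<zeta>)))\<^sup>2)"
      if f: "f holomorphic_on ball 0 1" for f
    proof -
      obtain B where B: "\<And>z. cmod z \<le> r \<Longrightarrow> cmod (f z) \<le> B"
        using holomorphic_disc_bounded[OF f r(2)] by blast
      have [measurable]: "(\<lambda>\<zeta>. f (complex_of_real r * \<zeta>)) \<in> borel_measurable circle_lebesgue"
        using circle_dilation_measurable[OF f r] by (simp add: measurable_cong_sets[OF sets_circle_lebesgue refl])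
      show ?thesis
        by (rule integrable_const_bound[where B = "B\<^sup>2"])
           (use r in \<open>auto intro!: B power_mono simp: norm_mult\<close>)
    qed
    have "(LINT \<zeta>|circle_lebesgue. (cmod (u (complex_of_real r * \<zeta>) * h (complex_of_real r * \<zeta>)))\<^sup>2)
       \<le> (LINT \<zeta>|circle_lebesgue. (cmod (h (complex_of_real r * \<zeta>)))\<^sup>2)"
    proof (intro integral_mono intg[OF uh] intg[OF hh])
      fix \<zeta> assume "\<zeta> \<in> space circle_lebesgue"
      then have "cmod (u (complex_of_real r * \<zeta>)) \<le> 1" using r u(2) by (simp add: norm_mult)
      then show "(cmod (u (complex_of_real r * \<zeta>) * h (complex_of_real r * \<zeta>)))\<^sup>2 \<le> (cmod (h (complex_of_real r * \<zeta>)))\<^sup>2"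
        by (intro power_mono) (auto simp: norm_mult mult_left_le_one_le)
    qed
    also have "\<dots> = (\<Sum>n. (cmod (taylor_coeff h n))\<^sup>2 * (r\<^sup>2) ^ n)"
      using Q by (simp add: sums_iff)
    also have "\<dots> \<le> hardy2_norm_sq h"
      unfolding hardy2_norm_sq_def
      using Q sh r by (intro suminf_le) (auto simp: sums_iff mult_left_le power_le_one)
    finally show ?thesis using P by (simp add: sums_iff)
  qed
  have "summable ?a \<and> suminf ?a \<le> hardy2_norm_sq h"
  proof (rule summable_of_bounded_abel_sums)
    fix r :: real assume "0 \<le> r" "r < 1"
    then show "summable (\<lambda>n. ?a n * r ^ n) \<and> (\<Sum>n. ?a n * r ^ n) \<le> hardy2_norm_sq h"
      using *[of "sqrt r"] by simp
  qed auto
  then show "(\<lambda>z. u z * h z) \<in> hardy2" "hardy2_norm_sq (\<lambda>z. u z * h z) \<le> hardy2_norm_sq h"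
    using uh by (auto simp: hardy2_def hardy2_norm_sq_def)
qed

lemma hardy2_norm_summable: "f \<in> hardy2 \<Longrightarrow> summable (\<lambda>n. (cmod (taylor_coeff f n))\<^sup>2)"
  by (simp add: hardy2_def)

lemma hardy2_cong:
  assumes "\<And>z. cmod z < 1 \<Longrightarrow> f z = g z"
  shows "f \<in> hardy2 \<longleftrightarrow> g \<in> hardy2"
proof -
  have "f holomorphic_on ball 0 1 \<longleftrightarrow> g holomorphic_on ball 0 1"
    by (rule holomorphic_cong) (use assms in auto)
  then show ?thesis
    by (simp add: hardy2_def fps_expansion_disc_cong[OF assms])
qed

lemma hardy2_inner_cong_left:
  "(\<And>z. cmod z < 1 \<Longrightarrow> f z = g z) \<Longrightarrow> hardy2_inner f h = hardy2_inner g h"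
  unfolding hardy2_inner_def by (subst fps_expansion_disc_cong[of f g]) auto

lemma hardy2_inner_summable:
  assumes "f \<in> hardy2" "g \<in> hardy2"
  shows "summable (\<lambda>n. taylor_coeff f n * cnj (taylor_coeff g n))"
proof (rule summable_comparison_test')
  show "summable (\<lambda>n. (cmod (taylor_coeff f n))\<^sup>2 + (cmod (taylor_coeff g n))\<^sup>2)"
    by (intro summable_add hardy2_norm_summable assms)
  have "x * y \<le> x\<^sup>2 + y\<^sup>2" if "0 \<le> x" "0 \<le> y" for x y :: real
    using sum_squares_bound[of x y] that mult_nonneg_nonneg[OF that] by linarith
  then show "norm (taylor_coeff f n * cnj (taylor_coeff g n)) \<le> (cmod (taylor_coeff f n))\<^sup>2 + (cmod (taylor_coeff g n))\<^sup>2" for n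
    by (simp add: norm_mult)
qed

lemma hardy2_cmult:
  assumes "f \<in> hardy2"
  shows "(\<lambda>z. c * f z) \<in> hardy2"
  using assms hardy2_holomorphic[OF assms]
  by (auto simp: hardy2_def fps_expansion_disc_cmult norm_mult power_mult_distrib intro!: holomorphic_intros summable_mult)

lemma hardy2_add:
  assumes f: "f \<in> hardy2" and g: "g \<in> hardy2"
  shows "(\<lambda>z. f z + g z) \<in> hardy2"
proof -
  have "summable (\<lambda>n. (cmod (taylor_coeff f n + taylor_coeff g n))\<^sup>2)"
  proof (rule summable_comparison_test')
    show "summable (\<lambda>n. 2 * ((cmod (taylor_coeff f n))\<^sup>2 + (cmod (taylor_coeff g n))\<^sup>2))"
      by (intro summable_add summable_mult hardy2_norm_summable assms)
    show "norm ((cmod (taylor_coeff f n + taylor_coeff g n))\<^sup>2) \<le> 2 * ((cmod (taylor_coeff f n))\<^sup>2 + (cmod (taylor_coeff g n))\<^sup>2)" for n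
    proof -
      let ?x = "cmod (taylor_coeff f n)" and ?y = "cmod (taylor_coeff g n)"
      have "(cmod (taylor_coeff f n + taylor_coeff g n))\<^sup>2 \<le> (?x + ?y)\<^sup>2"
        by (intro power_mono norm_triangle_ineq) auto
      also have "\<dots> \<le> 2 * (?x\<^sup>2 + ?y\<^sup>2)"
        using sum_squares_bound[of ?x ?y] by (simp add: power2_sum)
      finally show ?thesis by simp
    qed
  qed
  then show ?thesis
    using hardy2_holomorphic[OF f] hardy2_holomorphic[OF g]
    by (auto simp: hardy2_def fps_expansion_disc_add intro!: holomorphic_intros)
qed

lemma hardy2_diff:
  assumes "f \<in> hardy2" "g \<in> hardy2"
  shows "(\<lambda>z. f z - g z) \<in> hardy2"
  using hardy2_add[OF assms(1) hardy2_cmult[OF assms(2), of "-1"]] by simp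

lemma hardy2_power: "(\<lambda>z. z ^ n) \<in> hardy2"
  unfolding hardy2_def
  by (auto simp: fps_expansion_disc_power intro!: holomorphic_intros summable_finite[of "{n}"] split: if_splits)

lemma hardy2_inner_add_left:
  assumes "f \<in> hardy2" "g \<in> hardy2" "h \<in> hardy2"
  shows "hardy2_inner (\<lambda>z. f z + g z) h = hardy2_inner f h + hardy2_inner g h"
  using assms hardy2_inner_summable[of f h] hardy2_inner_summable[of g h]
  by (simp add: hardy2_inner_def fps_expansion_disc_add hardy2_holomorphic distrib_right suminf_add)

lemma hardy2_inner_diff_left:
  assumes "f \<in> hardy2" "g \<in> hardy2" "h \<in> hardy2"
  shows "hardy2_inner (\<lambda>z. f z - g z) h = hardy2_inner f h - hardy2_inner g h"
  using assms hardy2_inner_summable[of f h] hardy2_inner_summable[of g h]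
  by (simp add: hardy2_inner_def fps_expansion_disc_diff hardy2_holomorphic left_diff_distrib suminf_diff)

lemma hardy2_inner_cmult_left:
  assumes "f \<in> hardy2" "h \<in> hardy2"
  shows "hardy2_inner (\<lambda>z. c * f z) h = c * hardy2_inner f h"
  using assms hardy2_inner_summable[of f h]
  by (simp add: hardy2_inner_def fps_expansion_disc_cmult hardy2_holomorphic mult.assoc suminf_mult)

lemma hardy2_sum:
  assumes "\<And>k. k \<in> A \<Longrightarrow> f k \<in> hardy2" "finite A"
  shows "(\<lambda>z. \<Sum>k\<in>A. c k * f k z) \<in> hardy2"
  using assms(2,1)
proof (induction A rule: finite_induct)
  case empty
  show ?case using hardy2_cmult[OF hardy2_power[of 0], of 0] by simp
next
  case (insert x A)
  then show ?case using hardy2_add[OF hardy2_cmult[of "f x" "c x"]] by simp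
qed

lemma hardy2_inner_sum_left:
  assumes "\<And>k. k \<in> A \<Longrightarrow> f k \<in> hardy2" "finite A" "h \<in> hardy2"
  shows "hardy2_inner (\<lambda>z. \<Sum>k\<in>A. c k * f k z) h = (\<Sum>k\<in>A. c k * hardy2_inner (f k) h)"
  using assms(2,1)
proof (induction A rule: finite_induct)
  case empty
  show ?case using hardy2_inner_cmult_left[OF hardy2_power[of 0] assms(3), of 0] by simp
next
  case (insert x A)
  then show ?case
    using hardy2_inner_add_left[OF hardy2_cmult[of "f x" "c x"] hardy2_sum[of A f c] assms(3)]
      hardy2_inner_cmult_left[of "f x" h "c x"] assms(3) by simp
qed

lemma hardy2_inner_commute:
  assumes "f \<in> hardy2" "g \<in> hardy2"
  shows "hardy2_inner g f = cnj (hardy2_inner f g)"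
proof -
  have "(\<lambda>n. cnj (taylor_coeff f n * cnj (taylor_coeff g n))) sums cnj (hardy2_inner f g)"
    unfolding sums_cnj hardy2_inner_def
    using hardy2_inner_summable[OF assms] by (rule summable_sums)
  then show ?thesis
    by (simp add: hardy2_inner_def sums_iff mult.commute)
qed

lemma hardy2_inner_power_left: "hardy2_inner (\<lambda>z. z ^ k) h = cnj (taylor_coeff h k)"
proof -
  have "(\<lambda>n. taylor_coeff (\<lambda>z. z ^ k) n * cnj (taylor_coeff h n)) = (\<lambda>n. if n = k then cnj (taylor_coeff h k) else 0)"
    by (auto simp: fps_expansion_disc_power)
  then show ?thesis
    unfolding hardy2_inner_def using sums_single[of k "\<lambda>_. cnj (taylor_coeff h k)"] by (simp add: sums_iff)
qed

lemma hardy2_norm_sq_nonneg: "f \<in> hardy2 \<Longrightarrow> 0 \<le> hardy2_norm_sq f"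
  unfolding hardy2_norm_sq_def by (intro suminf_nonneg hardy2_norm_summable) auto

lemma hardy2_norm_sq_conv_inner:
  assumes "f \<in> hardy2"
  shows "hardy2_inner f f = complex_of_real (hardy2_norm_sq f)"
  using hardy2_norm_summable[OF assms]
  by (simp add: hardy2_inner_def hardy2_norm_sq_def complex_norm_square[symmetric] suminf_of_real
       del: of_real_power)

lemma hardy2_norm_sq_eq_0:
  assumes "f \<in> hardy2" "hardy2_norm_sq f = 0" "cmod z < 1"
  shows "f z = 0"
proof -
  have "taylor_coeff f n = 0" for n
    using assms(2) suminf_eq_zero_iff[OF hardy2_norm_summable[OF assms(1)]] by (simp add: hardy2_norm_sq_def)
  then show ?thesis
    using taylor_sums[OF hardy2_holomorphic[OF assms(1)] assms(3)] by (simp add: sums_iff)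
qed

lemma hardy2_norm_sq_add_cmult:
  assumes f: "f \<in> hardy2" and g: "g \<in> hardy2"
  shows "hardy2_norm_sq (\<lambda>z. f z + c * g z) =
           hardy2_norm_sq f + 2 * Re (cnj c * hardy2_inner f g) + (cmod c)\<^sup>2 * hardy2_norm_sq g"
proof -
  let ?h = "\<lambda>z. f z + c * g z"
  have cg: "(\<lambda>z. c * g z) \<in> hardy2" by (rule hardy2_cmult[OF g])
  have h: "?h \<in> hardy2" by (rule hardy2_add[OF f cg])
  have "complex_of_real (hardy2_norm_sq ?h) = hardy2_inner f ?h + c * hardy2_inner g ?h"
    unfolding hardy2_norm_sq_conv_inner[OF h, symmetric]
    using hardy2_inner_add_left[OF f cg h] hardy2_inner_cmult_left[OF g h, of c] by simp
  also have "hardy2_inner f ?h = cnj (hardy2_inner f f + c * hardy2_inner g f)"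
    using hardy2_inner_commute[OF h f] hardy2_inner_add_left[OF f cg f] hardy2_inner_cmult_left[OF g f, of c] by simp
  also have "hardy2_inner g ?h = cnj (hardy2_inner f g + c * hardy2_inner g g)"
    using hardy2_inner_commute[OF h g] hardy2_inner_add_left[OF f cg g] hardy2_inner_cmult_left[OF g g, of c] by simp
  finally have "complex_of_real (hardy2_norm_sq ?h) =
     complex_of_real (hardy2_norm_sq f) + (cnj c * hardy2_inner f g + cnj (cnj c * hardy2_inner f g)) + c * cnj c * complex_of_real (hardy2_norm_sq g)"
    by (simp add: hardy2_norm_sq_conv_inner f g hardy2_inner_commute[OF f g] algebra_simps)
  also have "\<dots> = complex_of_real (hardy2_norm_sq f + 2 * Re (cnj c * hardy2_inner f g) + (cmod c)\<^sup>2 * hardy2_norm_sq g)"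
    unfolding complex_add_cnj complex_norm_square[symmetric] by simp
  finally show ?thesis by (simp only: of_real_eq_iff)
qed

lemma hardy2_norm_sq_power: "hardy2_norm_sq (\<lambda>z. z ^ k) = 1"
  using hardy2_norm_sq_conv_inner[OF hardy2_power[of k]]
  by (simp add: hardy2_inner_power_left fps_expansion_disc_power of_real_eq_1_iff[symmetric])

lemma hardy2_norm_sq_shift:
  assumes u: "u \<in> hardy2"
  shows "hardy2_norm_sq (\<lambda>z. u z * z ^ k) = hardy2_norm_sq u"
proof -
  have "fps_expansion (\<lambda>z. u z * z ^ k) 0 = fps_expansion u 0 * fps_X ^ k"
    by (subst fps_expansion_disc_mult) (use u in \<open>auto simp: hardy2_holomorphic fps_expansion_disc_power intro!: holomorphic_intros\<close>)
  then have c: "taylor_coeff (\<lambda>z. u z * z ^ k) n = (if n < k then 0 else taylor_coeff u (n - k))" for n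
    by (simp add: fps_X_power_mult_right_nth)
  have "(\<lambda>n. (cmod (taylor_coeff (\<lambda>z. u z * z ^ k) (n + k)))\<^sup>2) sums hardy2_norm_sq u"
    unfolding c hardy2_norm_sq_def using summable_sums[OF hardy2_norm_summable[OF u]] by simp
  then show ?thesis
    unfolding hardy2_norm_sq_def[of "\<lambda>z. u z * z ^ k"]
    by (subst (asm) sums_iff_shift) (simp add: c sums_iff)
qed

section \<open>The projection of a monomial onto the model space\<close>

text \<open>
  The hypotheses make \<open>u\<close> an inner function: \<open>\<bar>u\<bar> \<le> 1\<close> on the disc and the norm of \<open>u\<close>, the mean of
  the boundary values of \<open>\<bar>u\<bar>\<^sup>2\<close>, is 1. Since \<open>z ^ k\<close> and \<open>u z * z ^ k\<close> both have norm 1, comparing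
  the norms of \<open>u z * (z ^ k + c * h z)\<close> and \<open>z ^ k + c * h z\<close> bounds a term linear in \<open>c\<close> by a
  quadratic one. For small \<open>c\<close> this forces the linear term, which is the defect \<open>D\<close> of the inner
  products, to vanish.
\<close>

lemma hardy2_inner_mult_inner_isometry:
  assumes u: "u holomorphic_on ball 0 1" "\<forall>z. cmod z < 1 \<longrightarrow> cmod (u z) \<le> 1"
    and u1: "hardy2_norm_sq u = 1" and h: "h \<in> hardy2"
  shows "hardy2_inner (\<lambda>z. u z * z ^ k) (\<lambda>z. u z * h z) = cnj (taylor_coeff h k)"
proof -
  note C = hardy2_mult_contraction[OF u]
  have uH: "u \<in> hardy2" using C(1)[OF hardy2_power[of 0]] by simp
  have uk: "(\<lambda>z. u z * z ^ k) \<in> hardy2" by (rule C(1)[OF hardy2_power])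
  have uh: "(\<lambda>z. u z * h z) \<in> hardy2" by (rule C(1)[OF h])
  define D where "D = hardy2_inner (\<lambda>z. u z * z ^ k) (\<lambda>z. u z * h z) - cnj (taylor_coeff h k)"
  define S where "S = hardy2_norm_sq h"
  have S: "0 \<le> S" unfolding S_def by (rule hardy2_norm_sq_nonneg[OF h])
  have le: "2 * Re (cnj c * D) \<le> (cmod c)\<^sup>2 * S" for c
  proof -
    have "hardy2_norm_sq (\<lambda>z. u z * z ^ k + c * (u z * h z)) = hardy2_norm_sq (\<lambda>z. u z * (z ^ k + c * h z))"
      by (simp add: algebra_simps)
    also have "\<dots> \<le> hardy2_norm_sq (\<lambda>z. z ^ k + c * h z)"
      by (intro C(2) hardy2_add hardy2_cmult h hardy2_power)
    finally have "2 * Re (cnj c * hardy2_inner (\<lambda>z. u z * z ^ k) (\<lambda>z. u z * h z)) + (cmod c)\<^sup>2 * hardy2_norm_sq (\<lambda>z. u z * h z)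
       \<le> 2 * Re (cnj c * cnj (taylor_coeff h k)) + (cmod c)\<^sup>2 * S"
      by (simp add: hardy2_norm_sq_add_cmult uk uh h hardy2_power hardy2_norm_sq_power hardy2_norm_sq_shift uH u1
            hardy2_inner_power_left S_def)
    moreover have "0 \<le> (cmod c)\<^sup>2 * hardy2_norm_sq (\<lambda>z. u z * h z)"
      by (intro mult_nonneg_nonneg hardy2_norm_sq_nonneg uh) auto
    moreover have "Re (cnj c * D) = Re (cnj c * hardy2_inner (\<lambda>z. u z * z ^ k) (\<lambda>z. u z * h z)) - Re (cnj c * cnj (taylor_coeff h k))"
      by (simp add: D_def algebra_simps)
    ultimately show ?thesis by linarith
  qed
  have "D = 0"
  proof (rule ccontr)
    assume D: "D \<noteq> 0"
    \<comment> \<open>Any \<open>s > 0\<close> with \<open>s * S < 2\<close> would contradict the estimate for \<open>c = s * D\<close>.\<close>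
    define s where "s = 1 / (1 + S)"
    have s: "0 < s" "s * S < 1" using S by (auto simp: s_def field_simps)
    have "2 * (s * (cmod D)\<^sup>2) \<le> s\<^sup>2 * (cmod D)\<^sup>2 * S"
    proof -
      have "cnj (complex_of_real s * D) * D = complex_of_real (s * (cmod D)\<^sup>2)"
        by (simp add: complex_norm_square mult_ac del: of_real_power)
      then have "Re (cnj (complex_of_real s * D) * D) = s * (cmod D)\<^sup>2"
        by (simp only: Re_complex_of_real)
      then show ?thesis
        using le[of "complex_of_real s * D"] by (simp only: norm_mult power_mult_distrib) simp
    qed
    then have "(s * (cmod D)\<^sup>2) * 2 \<le> (s * (cmod D)\<^sup>2) * (s * S)"
      by (simp add: power2_eq_square mult_ac)
    then have "2 \<le> s * S" using s D by (subst (asm) mult_le_cancel_left_pos) auto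
    with s show False by simp
  qed
  then show ?thesis by (simp add: D_def)
qed

text \<open>
  The sum is \<open>P\<^sub>+(cnj u * z ^ n)\<close>, a polynomial \<open>q\<close>. The product \<open>u q\<close> lies in \<open>u H\<^sup>2\<close>, and it has the
  same inner products as \<open>z ^ n\<close> with all \<open>u h\<close>: by the isometry these are inner products of \<open>q\<close>
  with \<open>h\<close>, that is, the conjugated Cauchy product for the coefficient \<open>n\<close> of \<open>u h\<close>. So \<open>u q\<close> is
  the component of \<open>z ^ n\<close> in \<open>u H\<^sup>2\<close>.
\<close>

lemma model_proj_power:
  assumes u: "u holomorphic_on ball 0 1" "\<forall>z. cmod z < 1 \<longrightarrow> cmod (u z) \<le> 1"
    and u1: "hardy2_norm_sq u = 1" and w: "cmod w < 1"
  shows "model_proj u (\<lambda>z. z ^ n) w = w ^ n - u w * (\<Sum>k\<le>n. cnj (taylor_coeff u (n - k)) * w ^ k)"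
proof -
  note C = hardy2_mult_contraction[OF u]
  define q where "q = (\<lambda>z::complex. \<Sum>k\<le>n. cnj (taylor_coeff u (n - k)) * z ^ k)"
  define uq where "uq = (\<lambda>z. u z * q z)"
  define p where "p = (\<lambda>z. if cmod z < 1 then z ^ n - uq z else 0)"
  have q: "q \<in> hardy2" unfolding q_def by (intro hardy2_sum hardy2_power) auto
  have uq: "uq \<in> hardy2" unfolding uq_def by (rule C(1)[OF q])
  have p_disc: "p z = z ^ n - uq z" if "cmod z < 1" for z using that by (simp add: p_def)
  have p: "p \<in> hardy2"
    using hardy2_diff[OF hardy2_power[of n] uq] hardy2_cong[of p "\<lambda>z. z ^ n - uq z"] p_disc by blast
  have uq_uh: "hardy2_inner uq (\<lambda>z. u z * h z) = hardy2_inner (\<lambda>z. z ^ n) (\<lambda>z. u z * h z)" if h: "h \<in> hardy2" for h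
  proof -
    have "uq = (\<lambda>z. \<Sum>k\<le>n. cnj (taylor_coeff u (n - k)) * (u z * z ^ k))"
      by (simp add: uq_def q_def fun_eq_iff sum_distrib_left mult_ac)
    then have "hardy2_inner uq (\<lambda>z. u z * h z) =
        (\<Sum>k\<le>n. cnj (taylor_coeff u (n - k)) * hardy2_inner (\<lambda>z. u z * z ^ k) (\<lambda>z. u z * h z))"
      by (simp only:) (intro hardy2_inner_sum_left C(1) hardy2_power h, auto)
    also have "\<dots> = (\<Sum>k\<le>n. cnj (taylor_coeff u (n - k)) * cnj (taylor_coeff h k))"
      by (simp add: hardy2_inner_mult_inner_isometry[OF u u1 h])
    also have "\<dots> = cnj (taylor_coeff (\<lambda>z. h z * u z) n)"
      by (simp add: fps_expansion_disc_mult[OF hardy2_holomorphic[OF h] u(1)] fps_mult_nth atLeast0AtMost mult.commute)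
    also have "\<dots> = hardy2_inner (\<lambda>z. z ^ n) (\<lambda>z. u z * h z)"
      by (simp add: hardy2_inner_power_left mult.commute)
    finally show ?thesis .
  qed
  have pm: "p \<in> model_space u"
    unfolding model_space_def
  proof (intro CollectI conjI p ballI)
    fix h assume h: "h \<in> hardy2"
    have "hardy2_inner p (\<lambda>z. u z * h z) = hardy2_inner (\<lambda>z. z ^ n - uq z) (\<lambda>z. u z * h z)"
      by (rule hardy2_inner_cong_left[OF p_disc])
    also have "\<dots> = 0"
      using hardy2_inner_diff_left[OF hardy2_power uq C(1)[OF h]] uq_uh[OF h] by simp
    finally show "hardy2_inner p (\<lambda>z. u z * h z) = 0" .
  qed
  have po: "hardy2_inner (\<lambda>z. z ^ n - p z) h = 0" if h: "h \<in> model_space u" for h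
  proof -
    have hH: "h \<in> hardy2" and "hardy2_inner h uq = 0"
      using h q by (auto simp: model_space_def uq_def)
    then have "hardy2_inner uq h = 0"
      using hardy2_inner_commute[OF hH uq] by simp
    moreover have "hardy2_inner (\<lambda>z. z ^ n - p z) h = hardy2_inner uq h"
      by (rule hardy2_inner_cong_left) (simp add: p_disc)
    ultimately show ?thesis by simp
  qed
  have "model_proj u (\<lambda>z. z ^ n) = p"
    unfolding model_proj_def
  proof (rule the_equality)
    show "p \<in> model_space u \<and> (\<forall>h\<in>model_space u. hardy2_inner (\<lambda>z. z ^ n - p z) h = 0) \<and>
            (\<forall>z. z \<notin> ball 0 1 \<longrightarrow> p z = 0)"
      using pm po by (auto simp: p_def)
  next
    fix p' assume p': "p' \<in> model_space u \<and> (\<forall>h\<in>model_space u. hardy2_inner (\<lambda>z. z ^ n - p' z) h = 0) \<and>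
            (\<forall>z. z \<notin> ball 0 1 \<longrightarrow> p' z = 0)"
    then have p'H: "p' \<in> hardy2" by (simp add: model_space_def)
    define d where "d = (\<lambda>z. p z - p' z)"
    have dH: "d \<in> hardy2" unfolding d_def by (rule hardy2_diff[OF p p'H])
    have d: "d \<in> model_space u"
      unfolding model_space_def
    proof (intro CollectI conjI dH ballI)
      fix h assume h: "h \<in> hardy2"
      show "hardy2_inner d (\<lambda>z. u z * h z) = 0"
        unfolding d_def using pm p' h
        by (subst hardy2_inner_diff_left[OF p p'H C(1)[OF h]]) (auto simp: model_space_def)
    qed
    have "d = (\<lambda>z. (z ^ n - p' z) - (z ^ n - p z))" by (simp add: d_def)
    then have "hardy2_inner d d = hardy2_inner (\<lambda>z. (z ^ n - p' z) - (z ^ n - p z)) d" by simp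
    also have "\<dots> = hardy2_inner (\<lambda>z. z ^ n - p' z) d - hardy2_inner (\<lambda>z. z ^ n - p z) d"
      by (intro hardy2_inner_diff_left hardy2_diff hardy2_power p p'H dH)
    also have "\<dots> = 0" using po[OF d] p' d by simp
    finally have "hardy2_norm_sq d = 0" using hardy2_norm_sq_conv_inner[OF dH] by simp
    then have "p z = p' z" if "cmod z < 1" for z
      using hardy2_norm_sq_eq_0[OF dH _ that] by (simp add: d_def)
    then show "p' = p" using p' by (auto simp: fun_eq_iff p_def)
  qed
  then show ?thesis using w by (simp add: p_def uq_def q_def)
qed

section \<open>The Herglotz transform of a measure on the circle\<close>

lemma herglotz_kernel_sums:
  assumes "cmod \<zeta> = 1" "cmod z < 1"
  shows "(\<lambda>n. (if n = 0 then 1 else 2) * cnj \<zeta> ^ n * z ^ n) sums ((\<zeta> + z) / (\<zeta> - z))"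
proof -
  let ?x = "cnj \<zeta> * z"
  have x: "cmod ?x < 1" using assms by (simp add: norm_mult)
  have ne: "\<zeta> \<noteq> z" using assms by auto
  have x1: "1 - ?x \<noteq> 0" using x by auto
  have u: "\<zeta> * cnj \<zeta> = 1" by (rule unit_cnj_mult[OF assms(1)])
  have "(\<lambda>n. 2 * ?x ^ n - (if n = 0 then 1 else 0)) sums (2 * (1 / (1 - ?x)) - 1)"
    by (intro sums_diff sums_mult geometric_sums x) (use sums_single[of 0 "\<lambda>_. 1::complex"] in simp)
  also have "(\<lambda>n. 2 * ?x ^ n - (if n = 0 then 1 else 0)) = (\<lambda>n. (if n = 0 then 1 else 2) * cnj \<zeta> ^ n * z ^ n)"
    by (auto simp: power_mult_distrib)
  also have "2 * (1 / (1 - ?x)) - 1 = (\<zeta> + z) / (\<zeta> - z)"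
  proof -
    have "2 * (1 / (1 - ?x)) - 1 = (1 + ?x) / (1 - ?x)" using x1 by (simp add: field_simps)
    also have "\<dots> = (\<zeta> * (1 + ?x)) / (\<zeta> * (1 - ?x))" using assms(1) by auto
    also have "\<zeta> * (1 + ?x) = \<zeta> + z" using u by (simp add: distrib_left mult.assoc[symmetric])
    also have "\<zeta> * (1 - ?x) = \<zeta> - z" using u by (simp add: right_diff_distrib mult.assoc[symmetric])
    finally show ?thesis .
  qed
  finally show ?thesis .
qed

lemma Re_herglotz_kernel:
  assumes "cmod \<zeta> = 1"
  shows "Re ((\<zeta> + z) / (\<zeta> - z)) = (1 - (cmod z)\<^sup>2) / (cmod (\<zeta> - z))\<^sup>2"
proof -
  have "Re ((\<zeta> + z) * cnj (\<zeta> - z)) = (cmod \<zeta>)\<^sup>2 - (cmod z)\<^sup>2"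
    unfolding cmod_power2 by (simp add: power2_eq_square algebra_simps)
  then show ?thesis
    using assms by (simp add: complex_div_cnj[of "\<zeta> + z"] Re_divide_of_real flip: of_real_power)
qed

text \<open>
  Arbitrary finite mass is allowed so that the results also apply to the restrictions of a
  probability measure to subsets of the circle.
\<close>

locale finite_circle_measure = finite_measure \<mu> for \<mu> :: "complex measure" +
  assumes sets_eq [measurable_cong]: "sets \<mu> = sets circle_borel"

lemma finite_circle_measure_circle_lebesgue: "finite_circle_measure circle_lebesgue"
  by (intro finite_circle_measure.intro finite_circle_measure_axioms.intro
        prob_space.axioms(1)[OF prob_space_circle_lebesgue] sets_circle_lebesgue)

context finite_circle_measure
begin

lemma space_eq: "space \<mu> = sphere 0 1"
  using sets_eq_imp_space_eq[OF sets_eq] by (simp add: space_restrict_space)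

lemma measurable_continuous:
  "continuous_on (sphere 0 1) f \<Longrightarrow> f \<in> borel_measurable \<mu>"
  unfolding measurable_cong_sets[OF sets_eq refl] by (rule circle_measurable_continuous)

lemma integrable_continuous:
  fixes f :: "complex \<Rightarrow> 'b::{banach, second_countable_topology}"
  assumes "continuous_on (sphere 0 1) f"
  shows "integrable \<mu> f"
proof -
  have "bounded (f ` sphere 0 1)"
    by (intro compact_imp_bounded compact_continuous_image assms) auto
  then obtain B where "\<forall>x\<in>f ` sphere 0 1. norm x \<le> B"
    unfolding bounded_iff by blast
  then show ?thesis
    by (intro integrable_const_bound[where B = B] measurable_continuous assms AE_I2) (auto simp: space_eq)
qed

lemma herglotz_kernel_continuous:
  "cmod z < 1 \<Longrightarrow> continuous_on (sphere 0 1) (\<lambda>\<zeta>. (\<zeta> + z) / (\<zeta> - z))"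
  by (intro continuous_intros) auto

lemma herglotz_sums:
  assumes z: "cmod z < 1"
  shows "(\<lambda>n. (if n = 0 then 1 else 2) * cnj (LINT \<zeta>|\<mu>. \<zeta> ^ n) * z ^ n) sums herglotz \<mu> z"
proof -
  let ?k = "\<lambda>n \<zeta>. (if n = 0 then 1 else 2) * cnj \<zeta> ^ n * z ^ n"
  have int: "integrable \<mu> (?k n)" for n
    by (intro integrable_continuous continuous_intros)
  have nrm: "norm (?k n \<zeta>) = (if n = 0 then 1 else 2) * cmod z ^ n" if "\<zeta> \<in> space \<mu>" for n \<zeta>
    using that by (simp add: space_eq norm_mult norm_power)
  have s: "summable (\<lambda>n. (if n = 0 then 1 else 2) * cmod z ^ n)"
    by (rule summable_comparison_test'[where g = "\<lambda>n. 2 * cmod z ^ n"])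
       (auto intro!: summable_mult summable_geometric z)
  have "(\<lambda>n. LINT \<zeta>|\<mu>. ?k n \<zeta>) sums (LINT \<zeta>|\<mu>. (\<Sum>n. ?k n \<zeta>))"
  proof (rule sums_integral[OF int])
    show "AE \<zeta> in \<mu>. summable (\<lambda>n. norm (?k n \<zeta>))"
      by (rule AE_I2, subst nrm) (assumption, rule s)
    have "(\<lambda>n. LINT \<zeta>|\<mu>. norm (?k n \<zeta>)) = (\<lambda>n. ((if n = 0 then 1 else 2) * cmod z ^ n) * measure \<mu> (space \<mu>))"
    proof
      fix n
      have "(LINT \<zeta>|\<mu>. norm (?k n \<zeta>)) = (LINT \<zeta>|\<mu>. (if n = 0 then 1 else 2) * cmod z ^ n)"
        by (rule Bochner_Integration.integral_cong[OF refl nrm])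
      then show "(LINT \<zeta>|\<mu>. norm (?k n \<zeta>)) = ((if n = 0 then 1 else 2) * cmod z ^ n) * measure \<mu> (space \<mu>)"
        by simp
    qed
    then show "summable (\<lambda>n. LINT \<zeta>|\<mu>. norm (?k n \<zeta>))"
      using summable_mult2[OF s] by simp
  qed
  also have "(LINT \<zeta>|\<mu>. (\<Sum>n. ?k n \<zeta>)) = herglotz \<mu> z"
    unfolding herglotz_def
    by (rule Bochner_Integration.integral_cong[OF refl])
       (use herglotz_kernel_sums[OF _ z] in \<open>auto simp: space_eq sums_iff\<close>)
  also have "(\<lambda>n. LINT \<zeta>|\<mu>. ?k n \<zeta>) = (\<lambda>n. (if n = 0 then 1 else 2) * cnj (LINT \<zeta>|\<mu>. \<zeta> ^ n) * z ^ n)"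
    by (simp add: fun_eq_iff flip: complex_cnj_power)
  finally show ?thesis .
qed

lemma herglotz_holomorphic: "herglotz \<mu> holomorphic_on ball 0 1"
  by (rule taylor_coeff_eqI(1)[OF herglotz_sums])

lemma taylor_coeff_herglotz:
  "taylor_coeff (herglotz \<mu>) n = (if n = 0 then 1 else 2) * cnj (LINT \<zeta>|\<mu>. \<zeta> ^ n)"
  by (rule taylor_coeff_eqI(2)[OF herglotz_sums])

lemma Re_herglotz:
  assumes z: "cmod z < 1"
  shows "Re (herglotz \<mu> z) = (LINT \<zeta>|\<mu>. (1 - (cmod z)\<^sup>2) / (cmod (\<zeta> - z))\<^sup>2)"
proof -
  have "Re (herglotz \<mu> z) = (LINT \<zeta>|\<mu>. Re ((\<zeta> + z) / (\<zeta> - z)))"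
    unfolding herglotz_def
    by (rule integral_Re[symmetric]) (intro integrable_continuous herglotz_kernel_continuous z)
  also have "\<dots> = (LINT \<zeta>|\<mu>. (1 - (cmod z)\<^sup>2) / (cmod (\<zeta> - z))\<^sup>2)"
    by (rule Bochner_Integration.integral_cong[OF refl]) (rule Re_herglotz_kernel, simp add: space_eq)
  finally show ?thesis .
qed

lemma Re_herglotz_nonneg:
  assumes "cmod z < 1"
  shows "0 \<le> Re (herglotz \<mu> z)"
  unfolding Re_herglotz[OF assms]
  by (intro integral_nonneg_AE AE_I2 divide_nonneg_nonneg) (use assms in \<open>auto simp: power_le_one_iff\<close>)

text \<open>
  The mean value property of the holomorphic Herglotz transform gives the mean of the Poisson
  integral over a circle without an interchange of integrals.
\<close>

lemma Re_herglotz_mean: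
  assumes "0 \<le> r" "r < 1"
  shows "integrable circle_lebesgue (\<lambda>\<zeta>. Re (herglotz \<mu> (complex_of_real r * \<zeta>)))"
    and "(LINT \<zeta>|circle_lebesgue. Re (herglotz \<mu> (complex_of_real r * \<zeta>))) = measure \<mu> (space \<mu>)"
proof -
  interpret m: finite_circle_measure circle_lebesgue by (rule finite_circle_measure_circle_lebesgue)
  have int: "integrable circle_lebesgue (\<lambda>\<zeta>. herglotz \<mu> (complex_of_real r * \<zeta>))"
    by (intro m.integrable_continuous continuous_on_compose2[OF holomorphic_on_imp_continuous_on[OF herglotz_holomorphic]])
       (use assms in \<open>auto intro!: continuous_intros simp: norm_mult\<close>)
  then show "integrable circle_lebesgue (\<lambda>\<zeta>. Re (herglotz \<mu> (complex_of_real r * \<zeta>)))"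
    by (rule integrable_Re)
  have "(LINT \<zeta>|circle_lebesgue. Re (herglotz \<mu> (complex_of_real r * \<zeta>))) =
        Re (LINT \<zeta>|circle_lebesgue. herglotz \<mu> (complex_of_real r * \<zeta>))"
    by (rule integral_Re[OF int])
  also have "\<dots> = measure \<mu> (space \<mu>)"
    using integral_circle_dilation_coeff[OF herglotz_holomorphic assms, of 0]
    by (simp add: taylor_coeff_herglotz)
  finally show "(LINT \<zeta>|circle_lebesgue. Re (herglotz \<mu> (complex_of_real r * \<zeta>))) = measure \<mu> (space \<mu>)" .
qed

lemma finite_circle_measure_density:
  assumes "A \<in> sets \<mu>"
  shows "finite_circle_measure (density \<mu> (indicator A))"
proof (intro finite_circle_measure.intro finite_measureI finite_circle_measure_axioms.intro)
  show "emeasure (density \<mu> (indicator A)) (space (density \<mu> (indicator A))) \<noteq> \<infinity>"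
    using assms by (simp add: emeasure_restricted)
qed (simp add: sets_eq)

lemma integral_density_indicator:
  fixes f :: "complex \<Rightarrow> 'b::{banach, second_countable_topology}"
  assumes A: "A \<in> sets \<mu>" and f: "f \<in> borel_measurable \<mu>"
  shows "(LINT \<zeta>|density \<mu> (indicator A). f \<zeta>) = (LINT \<zeta>|\<mu>. indicator A \<zeta> *\<^sub>R f \<zeta>)"
proof -
  have "density \<mu> (indicator A) = density \<mu> (\<lambda>x. ennreal (indicator A x))"
    by (simp add: ennreal_indicator)
  then show ?thesis
    using integral_density[OF f, of "indicator A"] A by simp
qed

lemma herglotz_split:
  assumes z: "cmod z < 1" and A: "A \<in> sets \<mu>"
  shows "herglotz \<mu> z = herglotz (density \<mu> (indicator A)) z + herglotz (density \<mu> (indicator (space \<mu> - A))) z"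
proof -
  let ?k = "\<lambda>\<zeta>. (\<zeta> + z) / (\<zeta> - z)"
  have B: "space \<mu> - A \<in> sets \<mu>" using A by auto
  have k: "integrable \<mu> ?k"
    by (intro integrable_continuous herglotz_kernel_continuous z)
  have "herglotz (density \<mu> (indicator A)) z + herglotz (density \<mu> (indicator (space \<mu> - A))) z =
        (LINT \<zeta>|\<mu>. indicator A \<zeta> *\<^sub>R ?k \<zeta>) + (LINT \<zeta>|\<mu>. indicator (space \<mu> - A) \<zeta> *\<^sub>R ?k \<zeta>)"
    unfolding herglotz_def using A B k by (simp add: integral_density_indicator)
  also have "\<dots> = (LINT \<zeta>|\<mu>. indicator A \<zeta> *\<^sub>R ?k \<zeta> + indicator (space \<mu> - A) \<zeta> *\<^sub>R ?k \<zeta>)"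
    by (rule Bochner_Integration.integral_add[symmetric]) (intro integrable_mult_indicator A B k)+
  also have "\<dots> = herglotz \<mu> z"
    unfolding herglotz_def
    by (rule Bochner_Integration.integral_cong[OF refl]) (auto split: split_indicator)
  finally show ?thesis ..
qed

text \<open>
  The map \<open>p \<mapsto> (p - 1) / (p + 1)\<close> sends the right half plane into the unit disc, with
  \<open>1 - \<bar>(p - 1) / (p + 1)\<bar>\<^sup>2 = 4 Re p / \<bar>p + 1\<bar>\<^sup>2\<close>.
\<close>

lemma inner_fun_of_bounds:
  assumes z: "cmod z < 1"
  shows "herglotz \<mu> z + 1 \<noteq> 0" "cmod (inner_fun_of \<mu> z) \<le> 1"
    "1 - (cmod (inner_fun_of \<mu> z))\<^sup>2 \<le> 4 * Re (herglotz \<mu> z)"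
proof -
  define p where "p = herglotz \<mu> z"
  have p: "0 \<le> Re p" unfolding p_def by (rule Re_herglotz_nonneg[OF z])
  have ge: "1 \<le> cmod (p + 1)" using complex_Re_le_cmod[of "p + 1"] p by simp
  then show ne: "herglotz \<mu> z + 1 \<noteq> 0" unfolding p_def by auto
  have diff: "(cmod (p + 1))\<^sup>2 - (cmod (p - 1))\<^sup>2 = 4 * Re p"
    unfolding cmod_power2 by (simp add: power2_eq_square algebra_simps)
  have eq: "1 - (cmod (inner_fun_of \<mu> z))\<^sup>2 = 4 * Re p / (cmod (p + 1))\<^sup>2"
    using ge unfolding inner_fun_of_def p_def[symmetric] diff[symmetric]
    by (subst diff_divide_distrib) (auto simp: norm_divide power_divide)
  have "0 \<le> 4 * Re p / (cmod (p + 1))\<^sup>2"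
    using p by simp
  then have "(cmod (inner_fun_of \<mu> z))\<^sup>2 \<le> 1\<^sup>2"
    unfolding eq[symmetric] by simp
  then show "cmod (inner_fun_of \<mu> z) \<le> 1"
    by (rule power2_le_imp_le) simp
  have "4 * Re p / (cmod (p + 1))\<^sup>2 \<le> 4 * Re p / 1"
    by (rule divide_left_mono) (use p ge in \<open>auto simp: one_le_power\<close>)
  then show "1 - (cmod (inner_fun_of \<mu> z))\<^sup>2 \<le> 4 * Re (herglotz \<mu> z)"
    using eq p_def by simp
qed

lemma one_minus_inner_fun_of:
  assumes z: "cmod z < 1"
  shows "1 - inner_fun_of \<mu> z = 2 / (herglotz \<mu> z + 1)"
proof -
  have "1 - a / b = (b - a) / b" if "b \<noteq> 0" for a b :: complex
    using that by (simp add: diff_divide_distrib)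
  from this[OF inner_fun_of_bounds(1)[OF z], of "herglotz \<mu> z - 1"] show ?thesis
    by (simp add: inner_fun_of_def)
qed

lemma inner_fun_of_holomorphic: "inner_fun_of \<mu> holomorphic_on ball 0 1"
  unfolding inner_fun_of_def[abs_def]
  by (intro holomorphic_intros herglotz_holomorphic) (use inner_fun_of_bounds(1) in auto)

end

section \<open>The function of a singular measure is inner\<close>

context finite_circle_measure
begin

lemma sets_imp_borel: "A \<in> sets \<mu> \<Longrightarrow> A \<in> sets borel \<and> A \<subseteq> sphere 0 1"
  by (auto simp: sets_eq sets_restrict_space_iff)

lemma borel_imp_sets: "A \<in> sets borel \<Longrightarrow> A \<inter> sphere 0 1 \<in> sets \<mu>"
  by (simp add: sets_eq sets_restrict_space_iff)

lemma measurable_id_borel: "(\<lambda>x. x) \<in> \<mu> \<rightarrow>\<^sub>M borel"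
  by (rule measurable_continuous) (rule continuous_on_id)

lemma emeasure_distr_borel:
  "B \<in> sets borel \<Longrightarrow> emeasure (distr \<mu> borel (\<lambda>x. x)) B = emeasure \<mu> (B \<inter> sphere 0 1)"
  by (simp add: emeasure_distr[OF measurable_id_borel] space_eq)

lemma distr_borel_finite:
  "emeasure (distr \<mu> borel (\<lambda>x. x)) (space (distr \<mu> borel (\<lambda>x. x))) \<noteq> \<infinity>"
  using emeasure_distr_borel[of UNIV] emeasure_finite by simp

text \<open>
  Regularity of Borel measures is a statement about measures on the whole plane, so \<open>\<mu>\<close> is first
  pushed forward along the inclusion of the circle. The same holds for outer approximation below.
\<close>

lemma compact_inner_approximation:
  assumes A: "A \<in> sets \<mu>" and e: "0 < e"
  obtains K where "compact K" "K \<subseteq> A" "K \<in> sets \<mu>" "measure \<mu> (A - K) < e"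
proof -
  note AB = sets_imp_borel[OF A]
  have sub: "K \<in> sets \<mu> \<and> emeasure (distr \<mu> borel (\<lambda>x. x)) K = measure \<mu> K" if "K \<subseteq> A" "compact K" for K
  proof -
    have "K \<in> sets borel" "K \<inter> sphere 0 1 = K"
      using that AB by (auto intro: borel_compact)
    then show ?thesis
      using emeasure_distr_borel[of K] borel_imp_sets[of K] by (simp add: emeasure_eq_measure)
  qed
  have Aeq: "emeasure (distr \<mu> borel (\<lambda>x. x)) A = measure \<mu> A"
    using emeasure_distr_borel[of A] AB by (simp add: emeasure_eq_measure Int_absorb2)
  obtain K where K: "K \<subseteq> A" "compact K" "measure \<mu> A - e < measure \<mu> K"
  proof (cases "measure \<mu> A < e")
    case True
    then show ?thesis using that[of "{}"] by simp
  next
    case False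
    have "ennreal (measure \<mu> A - e) < (SUP K \<in> {K. K \<subseteq> A \<and> compact K}. emeasure (distr \<mu> borel (\<lambda>x. x)) K)"
      unfolding inner_regular[OF sets_distr distr_borel_finite conjunct1[OF AB], symmetric] Aeq
      using False e by (intro ennreal_lessI) auto
    then obtain K where K: "K \<subseteq> A" "compact K" "ennreal (measure \<mu> A - e) < emeasure (distr \<mu> borel (\<lambda>x. x)) K"
      unfolding less_SUP_iff by auto
    then show ?thesis
      using that[of K] sub[of K] False by (simp add: ennreal_less_iff)
  qed
  moreover have "K \<in> sets \<mu>" using sub[OF K(1,2)] by simp
  moreover have "measure \<mu> (A - K) = measure \<mu> A - measure \<mu> K"
    by (rule finite_measure_Diff) (use A K \<open>K \<in> sets \<mu>\<close> in auto)
  ultimately show ?thesis using that[of K] by simp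
qed

lemma open_outer_approximation_null:
  assumes A: "A \<in> sets \<mu>" "emeasure \<mu> A = 0" and e: "0 < e"
  obtains U where "open U" "A \<subseteq> U" "emeasure \<mu> (U \<inter> sphere 0 1) < e"
proof -
  note AB = sets_imp_borel[OF A(1)]
  have "emeasure (distr \<mu> borel (\<lambda>x. x)) A = 0"
    using emeasure_distr_borel[of A] AB A(2) by (simp add: Int_absorb2)
  then have "(INF U \<in> {U. A \<subseteq> U \<and> open U}. emeasure (distr \<mu> borel (\<lambda>x. x)) U) < e"
    using outer_regular[OF sets_distr distr_borel_finite conjunct1[OF AB]] e by simp
  then obtain U where "A \<subseteq> U" "open U" "emeasure (distr \<mu> borel (\<lambda>x. x)) U < e"
    unfolding INF_less_iff by auto
  then show ?thesis using that[of U] emeasure_distr_borel[of U] by simp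
qed

text \<open>
  A point of the radius at \<open>\<zeta>\<close> that is close to the circle keeps the distance \<open>d / 2\<close> from a set
  \<open>K\<close> at distance \<open>d\<close> from \<open>\<zeta>\<close>, which bounds the Poisson kernel on \<open>K\<close>. The bound tends to 0 as
  \<open>r\<close> tends to 1.
\<close>

lemma Re_herglotz_restricted_le:
  assumes K: "K \<in> sets \<mu>" and d: "0 < d" "\<And>\<xi>. \<xi> \<in> K \<Longrightarrow> d \<le> cmod (\<xi> - \<zeta>)"
    and \<zeta>: "cmod \<zeta> = 1" and r: "0 \<le> r" "r < 1" "1 - r \<le> d / 2"
  shows "Re (herglotz (density \<mu> (indicator K)) (complex_of_real r * \<zeta>)) \<le> (1 - r\<^sup>2) / (d / 2)\<^sup>2 * measure \<mu> (space \<mu>)"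
proof -
  let ?z = "complex_of_real r * \<zeta>"
  let ?P = "\<lambda>\<xi>. (1 - (cmod ?z)\<^sup>2) / (cmod (\<xi> - ?z))\<^sup>2"
  have z: "cmod ?z = r" using \<zeta> r by (simp add: norm_mult)
  have cont: "continuous_on (sphere 0 1) ?P"
    using z r by (intro continuous_intros) auto
  have P: "indicator K \<xi> *\<^sub>R ?P \<xi> \<le> (1 - r\<^sup>2) / (d / 2)\<^sup>2" for \<xi>
  proof (cases "\<xi> \<in> K")
    case True
    have "cmod (\<zeta> - ?z) = 1 - r"
    proof -
      have "\<zeta> - ?z = complex_of_real (1 - r) * \<zeta>" by (simp add: algebra_simps)
      then show ?thesis using \<zeta> r by (simp only: norm_mult norm_of_real) simp
    qed
    then have "d / 2 \<le> cmod (\<xi> - ?z)"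
      using d(2)[OF True] r(3) norm_triangle_ineq4[of "\<xi> - ?z" "\<zeta> - ?z"] by simp
    then have "(d / 2)\<^sup>2 \<le> (cmod (\<xi> - ?z))\<^sup>2"
      using d by (intro power_mono) auto
    then have "?P \<xi> \<le> (1 - r\<^sup>2) / (d / 2)\<^sup>2"
      unfolding z using r d by (intro divide_left_mono) (auto simp: power_le_one intro!: mult_pos_pos)
    then show ?thesis using True by simp
  next
    case False
    then show ?thesis using r by (simp add: power_le_one)
  qed
  interpret K: finite_circle_measure "density \<mu> (indicator K)"
    by (rule finite_circle_measure_density[OF K])
  have "Re (herglotz (density \<mu> (indicator K)) ?z) = (LINT \<xi>|\<mu>. indicator K \<xi> *\<^sub>R ?P \<xi>)"
    using K.Re_herglotz[of ?z] integral_density_indicator[OF K measurable_continuous[OF cont]] z r by simp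
  also have "\<dots> \<le> (LINT \<xi>|\<mu>. (1 - r\<^sup>2) / (d / 2)\<^sup>2)"
    by (intro integral_mono integrable_mult_indicator K integrable_continuous[OF cont] P) simp
  finally show ?thesis by (simp add: mult.commute)
qed

text \<open>
  Parseval's identity bounds \<open>1 - \<parallel>\<phi>\<parallel>\<^sup>2\<close> by the mean of \<open>1 - \<bar>\<phi>\<bar>\<^sup>2\<close> over any circle of radius
  \<open>r < 1\<close>. Up to mass \<open>e\<close>, \<open>\<mu>\<close> is carried by a compact Lebesgue null set \<open>K\<close>. The part of \<open>\<mu>\<close> off
  \<open>K\<close> contributes at most four times its mass. The part on \<open>K\<close> contributes at most the mean of
  \<open>min 1 (4 Re \<psi>\<^sub>1)\<close>, which tends to 0 by dominated convergence, as the Poisson integral \<open>Re \<psi>\<^sub>1\<close>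
  tends to 0 radially off \<open>K\<close>, hence Lebesgue almost everywhere.
\<close>

lemma inner_fun_of_norm:
  assumes sing: "mutually_singular \<mu> circle_lebesgue"
  shows "hardy2_norm_sq (inner_fun_of \<mu>) = 1"
proof (rule antisym)
  let ?\<phi> = "inner_fun_of \<mu>"
  note hol = inner_fun_of_holomorphic
  have bd: "\<forall>z. cmod z < 1 \<longrightarrow> cmod (?\<phi> z) \<le> 1"
    using inner_fun_of_bounds(2) by blast
  have \<phi>: "?\<phi> \<in> hardy2"
    using hardy2_mult_contraction(1)[OF hol bd hardy2_power[of 0]] by simp
  show "hardy2_norm_sq ?\<phi> \<le> 1"
    using hardy2_mult_contraction(2)[OF hol bd hardy2_power[of 0]] hardy2_norm_sq_power[of 0] by simp
  interpret m: finite_circle_measure circle_lebesgue by (rule finite_circle_measure_circle_lebesgue)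
  have mass: "measure circle_lebesgue (space circle_lebesgue) = 1"
    by (rule prob_space.prob_space[OF prob_space_circle_lebesgue])
  have cont: "continuous_on (sphere 0 1) (\<lambda>\<zeta>. ?\<phi> (complex_of_real r * \<zeta>))" if "0 \<le> r" "r < 1" for r
    by (intro continuous_on_compose2[OF holomorphic_on_imp_continuous_on[OF hol]])
       (use that in \<open>auto intro!: continuous_intros simp: norm_mult\<close>)
  obtain A where A: "A \<in> sets \<mu>" "A \<in> sets circle_lebesgue" "emeasure \<mu> A = 0"
      "emeasure circle_lebesgue (sphere 0 1 - A) = 0"
    using sing by (auto simp: mutually_singular_def)
  define N where "N = sphere 0 1 - A"
  have N: "N \<in> sets \<mu>" unfolding N_def using A(1) by (simp flip: space_eq)
  have bound: "1 - hardy2_norm_sq ?\<phi> \<le> 4 * e" if e: "0 < e" for e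
  proof -
    obtain K where K: "compact K" "K \<subseteq> N" "K \<in> sets \<mu>" "measure \<mu> (N - K) < e"
      using compact_inner_approximation[OF N e] by blast
    have Km: "K \<in> sets circle_lebesgue" using K(3) by (simp add: sets_eq)
    have K0: "K \<in> null_sets circle_lebesgue"
    proof -
      have "N \<in> null_sets circle_lebesgue"
        using A(4) N by (auto simp: null_sets_def N_def sets_eq)
      then show ?thesis by (rule null_sets_subset[OF _ Km K(2)])
    qed
    define \<mu>1 where "\<mu>1 = density \<mu> (indicator K)"
    define \<mu>2 where "\<mu>2 = density \<mu> (indicator (space \<mu> - K))"
    have rest: "space \<mu> - K \<in> sets \<mu>" using K(3) by auto
    interpret \<mu>1: finite_circle_measure \<mu>1 unfolding \<mu>1_def by (rule finite_circle_measure_density[OF K(3)])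
    interpret \<mu>2: finite_circle_measure \<mu>2 unfolding \<mu>2_def by (rule finite_circle_measure_density[OF rest])
    have mass2: "measure \<mu>2 (space \<mu>2) \<le> e"
    proof -
      have "measure \<mu>2 (space \<mu>2) = measure \<mu> (space \<mu> - K)"
        unfolding \<mu>2_def using rest
        by (simp add: measure_def emeasure_restricted Int_absorb2 Int_absorb1)
      also have "\<dots> \<le> measure \<mu> (A \<union> (N - K))"
        by (rule finite_measure_mono) (use A N K in \<open>auto simp: N_def space_eq\<close>)
      also have "\<dots> \<le> measure \<mu> A + measure \<mu> (N - K)"
        by (rule measure_Un_le) (use A N K in auto)
      also have "measure \<mu> A = 0" using A(3) by (simp add: measure_def)
      finally show ?thesis using K(4) by simp
    qed
    let ?R1 = "\<lambda>r \<zeta>. Re (herglotz \<mu>1 (complex_of_real r * \<zeta>))"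
    let ?R2 = "\<lambda>r \<zeta>. Re (herglotz \<mu>2 (complex_of_real r * \<zeta>))"
    have int1: "integrable circle_lebesgue (\<lambda>\<zeta>. min 1 (4 * ?R1 r \<zeta>))" if r: "0 \<le> r" "r < 1" for r
      by (rule integrable_min) (use \<mu>1.Re_herglotz_mean(1)[OF r] in auto)
    have step: "1 - hardy2_norm_sq ?\<phi> \<le> (LINT \<zeta>|circle_lebesgue. min 1 (4 * ?R1 r \<zeta>)) + 4 * e"
      if r: "0 \<le> r" "r < 1" for r
    proof -
      have zr: "cmod (complex_of_real r * \<zeta>) < 1" if "\<zeta> \<in> space circle_lebesgue" for \<zeta>
        using that r by (simp add: norm_mult)
      have int\<phi>: "integrable circle_lebesgue (\<lambda>\<zeta>. (cmod (?\<phi> (complex_of_real r * \<zeta>)))\<^sup>2)"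
        by (intro m.integrable_continuous continuous_intros cont r)
      have int2: "integrable circle_lebesgue (\<lambda>\<zeta>. 4 * ?R2 r \<zeta>)"
        using \<mu>2.Re_herglotz_mean(1)[OF r] by simp
      have "(LINT \<zeta>|circle_lebesgue. (cmod (?\<phi> (complex_of_real r * \<zeta>)))\<^sup>2) \<le> hardy2_norm_sq ?\<phi>"
      proof -
        note P = parseval_circle[OF hol r]
        have le: "(cmod (taylor_coeff ?\<phi> n) * r ^ n)\<^sup>2 \<le> (cmod (taylor_coeff ?\<phi> n))\<^sup>2" for n
          using r by (intro power_mono) (auto simp: mult_left_le power_le_one)
        show ?thesis
          unfolding sums_unique[OF P] hardy2_norm_sq_def
          by (rule suminf_le[OF le sums_summable[OF P] hardy2_norm_summable[OF \<phi>]])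
      qed
      then have "1 - hardy2_norm_sq ?\<phi> \<le> (LINT \<zeta>|circle_lebesgue. 1 - (cmod (?\<phi> (complex_of_real r * \<zeta>)))\<^sup>2)"
        using int\<phi> mass by simp
      also have "\<dots> \<le> (LINT \<zeta>|circle_lebesgue. min 1 (4 * ?R1 r \<zeta>) + 4 * ?R2 r \<zeta>)"
      proof (rule integral_mono)
        fix \<zeta> assume \<zeta>: "\<zeta> \<in> space circle_lebesgue"
        have "0 \<le> ?R1 r \<zeta>" "0 \<le> ?R2 r \<zeta>"
          using \<mu>1.Re_herglotz_nonneg \<mu>2.Re_herglotz_nonneg zr[OF \<zeta>] by auto
        moreover have "1 - (cmod (?\<phi> (complex_of_real r * \<zeta>)))\<^sup>2 \<le> 4 * ?R1 r \<zeta> + 4 * ?R2 r \<zeta>"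
          using inner_fun_of_bounds(3)[OF zr[OF \<zeta>]] herglotz_split[OF zr[OF \<zeta>] K(3)]
          by (simp add: \<mu>1_def \<mu>2_def)
        moreover have "1 - (cmod (?\<phi> (complex_of_real r * \<zeta>)))\<^sup>2 \<le> 1" by simp
        ultimately show "1 - (cmod (?\<phi> (complex_of_real r * \<zeta>)))\<^sup>2 \<le> min 1 (4 * ?R1 r \<zeta>) + 4 * ?R2 r \<zeta>"
          by linarith
      next
        show "integrable circle_lebesgue (\<lambda>\<zeta>. 1 - (cmod (?\<phi> (complex_of_real r * \<zeta>)))\<^sup>2)"
          using int\<phi> by simp
        show "integrable circle_lebesgue (\<lambda>\<zeta>. min 1 (4 * ?R1 r \<zeta>) + 4 * ?R2 r \<zeta>)"
          by (rule Bochner_Integration.integrable_add[OF int1[OF r] int2])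
      qed
      also have "\<dots> = (LINT \<zeta>|circle_lebesgue. min 1 (4 * ?R1 r \<zeta>)) + 4 * measure \<mu>2 (space \<mu>2)"
        using \<mu>2.Re_herglotz_mean(2)[OF r] Bochner_Integration.integral_add[OF int1[OF r] int2] by simp
      finally show ?thesis using mass2 by linarith
    qed
    define \<rho> where "\<rho> = (\<lambda>j. 1 - inverse (real (Suc j)))"
    have \<rho>: "0 \<le> \<rho> j" "\<rho> j < 1" for j by (auto simp: \<rho>_def field_simps)
    have \<rho>_lim: "\<rho> \<longlonglongrightarrow> 1"
      unfolding \<rho>_def using tendsto_diff[OF tendsto_const[of "1::real"] LIMSEQ_inverse_real_of_nat] by simp
    have "(\<lambda>j. LINT \<zeta>|circle_lebesgue. min 1 (4 * ?R1 (\<rho> j) \<zeta>)) \<longlonglongrightarrow> (LINT \<zeta>|circle_lebesgue. (0::real))"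
    proof (rule integral_dominated_convergence[where w = "\<lambda>_. 1"])
      show "(\<lambda>\<zeta>. min 1 (4 * ?R1 (\<rho> j) \<zeta>)) \<in> borel_measurable circle_lebesgue" for j
        by (rule borel_measurable_integrable[OF int1[OF \<rho>]])
      show "AE \<zeta> in circle_lebesgue. norm (min 1 (4 * ?R1 (\<rho> j) \<zeta>)) \<le> 1" for j
      proof (rule AE_I2)
        fix \<zeta> assume "\<zeta> \<in> space circle_lebesgue"
        then have "0 \<le> ?R1 (\<rho> j) \<zeta>"
          using \<rho>[of j] by (intro \<mu>1.Re_herglotz_nonneg) (simp add: norm_mult)
        then show "norm (min 1 (4 * ?R1 (\<rho> j) \<zeta>)) \<le> 1" by simp
      qed
      show "AE \<zeta> in circle_lebesgue. (\<lambda>j. min 1 (4 * ?R1 (\<rho> j) \<zeta>)) \<longlonglongrightarrow> 0"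
        using AE_not_in[OF K0] AE_space
      proof eventually_elim
        case (elim \<zeta>)
        then have \<zeta>: "cmod \<zeta> = 1" by simp
        obtain d where d: "0 < d" "\<And>\<xi>. \<xi> \<in> K \<Longrightarrow> d \<le> cmod (\<xi> - \<zeta>)"
          using separate_point_closed[OF compact_imp_closed[OF K(1)] elim(1)]
          by (auto simp: dist_norm norm_minus_commute)
        have "eventually (\<lambda>j. 1 - d / 2 < \<rho> j) sequentially"
          by (rule order_tendstoD(1)[OF \<rho>_lim]) (use d in simp)
        then have "eventually (\<lambda>j. ?R1 (\<rho> j) \<zeta> \<le> (1 - (\<rho> j)\<^sup>2) / (d / 2)\<^sup>2 * measure \<mu> (space \<mu>)) sequentially"
          by eventually_elim (unfold \<mu>1_def, rule Re_herglotz_restricted_le[OF K(3) d \<zeta> \<rho>], auto)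
        moreover have "eventually (\<lambda>j. 0 \<le> ?R1 (\<rho> j) \<zeta>) sequentially"
          using \<rho> \<zeta> by (intro always_eventually allI \<mu>1.Re_herglotz_nonneg) (simp add: norm_mult)
        moreover have "(\<lambda>j. (1 - (\<rho> j)\<^sup>2) / (d / 2)\<^sup>2 * measure \<mu> (space \<mu>)) \<longlonglongrightarrow> (1 - 1\<^sup>2) / (d / 2)\<^sup>2 * measure \<mu> (space \<mu>)"
          by (intro tendsto_intros \<rho>_lim) (use d in auto)
        ultimately have "(\<lambda>j. ?R1 (\<rho> j) \<zeta>) \<longlonglongrightarrow> 0"
          using tendsto_sandwich[of "\<lambda>_. 0" "\<lambda>j. ?R1 (\<rho> j) \<zeta>" sequentially
             "\<lambda>j. (1 - (\<rho> j)\<^sup>2) / (d / 2)\<^sup>2 * measure \<mu> (space \<mu>)" 0] by simp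
        then have "(\<lambda>j. min 1 (4 * ?R1 (\<rho> j) \<zeta>)) \<longlonglongrightarrow> min 1 (4 * 0)"
          by (intro tendsto_intros)
        then show ?case by simp
      qed
    qed auto
    then have "(\<lambda>j. (LINT \<zeta>|circle_lebesgue. min 1 (4 * ?R1 (\<rho> j) \<zeta>)) + 4 * e) \<longlonglongrightarrow> 0 + 4 * e"
      by (intro tendsto_add) simp_all
    then show ?thesis
      by (intro tendsto_lowerbound[where F = sequentially]) (use step \<rho> in auto)
  qed
  show "1 \<le> hardy2_norm_sq ?\<phi>"
  proof (rule field_le_epsilon)
    fix e :: real assume "0 < e"
    then show "1 \<le> hardy2_norm_sq ?\<phi> + e" using bound[of "e / 4"] by simp
  qed
qed

section \<open>The Kaczmarz sequence of the monomials\<close>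

text \<open>
  With the moments \<open>c\<^sub>n\<close>, the recursion reads \<open>(\<Sum>k\<le>n. c\<^bsub>n-k\<^esub> g\<^sub>k) = \<zeta> ^ n\<close>, because \<open>c\<^sub>0 = 1\<close>. As
  power series this is \<open>G * C = Z\<close>. Since \<open>(\<psi> + 1) / 2\<close> has the coefficients \<open>cnj c\<^sub>n\<close>, the
  conjugated coefficients of \<open>1 - \<phi>\<close> form the inverse of \<open>C\<close>.
\<close>

lemma kaczmarz_dual_monomials:
  assumes mass: "measure \<mu> (space \<mu>) = 1"
  shows "kaczmarz_dual \<mu> (\<lambda>k \<omega>. \<omega> ^ k) n \<zeta> =
     \<zeta> ^ n - (\<Sum>k\<le>n. cnj (taylor_coeff (inner_fun_of \<mu>) (n - k)) * \<zeta> ^ k)"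
proof -
  let ?\<phi> = "inner_fun_of \<mu>"
  define c where "c n = (LINT \<omega>|\<mu>. \<omega> ^ n)" for n
  have c0: "c 0 = 1" using mass by (simp add: c_def)
  have moment: "l2_inner \<mu> (\<lambda>\<omega>. \<omega> ^ n) (\<lambda>\<omega>. \<omega> ^ k) = c (n - k)" if "k \<le> n" for n k
    unfolding l2_inner_def c_def
  proof (rule Bochner_Integration.integral_cong[OF refl])
    fix \<omega> assume "\<omega> \<in> space \<mu>"
    then have "\<omega> ^ k * cnj (\<omega> ^ k) = 1"
      using unit_cnj_mult[of \<omega>] by (simp add: space_eq flip: power_mult_distrib)
    moreover have "\<omega> ^ n = \<omega> ^ (n - k) * \<omega> ^ k" using that by (simp flip: power_add)
    ultimately show "\<omega> ^ n * cnj (\<omega> ^ k) = \<omega> ^ (n - k)" by (simp add: mult.assoc)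
  qed
  define C where "C = Abs_fps c"
  define B where "B = 1 - fps_expansion ?\<phi> 0"
  define A where "A = Abs_fps (\<lambda>n. cnj (fps_nth B n))"
  define Z where "Z = Abs_fps (\<lambda>k. \<zeta> ^ k)"
  have "B * Abs_fps (\<lambda>n. cnj (c n)) = 1"
  proof -
    have C: "(\<lambda>z. (herglotz \<mu> z + 1) / 2) has_fps_expansion Abs_fps (\<lambda>n. cnj (c n))"
    proof -
      have "(\<lambda>z. (1/2) * (herglotz \<mu> z + 1)) has_fps_expansion fps_const (1/2) * (fps_expansion (herglotz \<mu>) 0 + 1)"
        by (intro has_fps_expansion_cmult_left has_fps_expansion_add has_fps_expansion_1
              has_fps_expansion_disc herglotz_holomorphic)
      also have "fps_const (1/2) * (fps_expansion (herglotz \<mu>) 0 + 1) = Abs_fps (\<lambda>n. cnj (c n))"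
        by (rule fps_ext) (use c0 in \<open>auto simp: taylor_coeff_herglotz c_def[symmetric]\<close>)
      finally show ?thesis by simp
    qed
    have "(\<lambda>z. (1 - ?\<phi> z) * ((herglotz \<mu> z + 1) / 2)) has_fps_expansion B * Abs_fps (\<lambda>n. cnj (c n))"
      unfolding B_def
      by (intro has_fps_expansion_mult C has_fps_expansion_diff has_fps_expansion_1
            has_fps_expansion_disc inner_fun_of_holomorphic)
    then have "fps_expansion (\<lambda>z. (1 - ?\<phi> z) * ((herglotz \<mu> z + 1) / 2)) 0 = B * Abs_fps (\<lambda>n. cnj (c n))"
      by (rule fps_expansion_eqI)
    moreover have "fps_expansion (\<lambda>z. (1 - ?\<phi> z) * ((herglotz \<mu> z + 1) / 2)) 0 = fps_expansion (\<lambda>_. 1) 0"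
    proof (rule fps_expansion_disc_cong)
      fix z :: complex assume z: "cmod z < 1"
      show "(1 - ?\<phi> z) * ((herglotz \<mu> z + 1) / 2) = 1"
      proof -
        have "2 / b * (b / 2) = 1" if "b \<noteq> 0" for b :: complex using that by simp
        from this[OF inner_fun_of_bounds(1)[OF z]] show ?thesis
          unfolding one_minus_inner_fun_of[OF z] .
      qed
    qed
    moreover have "fps_expansion (\<lambda>_. 1::complex) 0 = 1"
      by (rule fps_expansion_eqI) (rule has_fps_expansion_1)
    ultimately show ?thesis by simp
  qed
  moreover have "fps_nth (A * C) n = cnj (fps_nth (B * Abs_fps (\<lambda>n. cnj (c n))) n)" for n
    by (simp add: A_def C_def fps_mult_nth)
  ultimately have "fps_nth (A * C) n = fps_nth 1 n" for n
    by simp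
  then have AC: "A * C = 1" by (rule fps_ext)
  define G where "G = Z * A"
  have G: "fps_nth G n = \<zeta> ^ n - (\<Sum>k\<le>n. cnj (taylor_coeff ?\<phi> (n - k)) * \<zeta> ^ k)" for n
  proof -
    have A: "fps_nth A (n - k) * \<zeta> ^ k = (if k = n then \<zeta> ^ n else 0) - cnj (taylor_coeff ?\<phi> (n - k)) * \<zeta> ^ k"
      if "k \<le> n" for k
      using that by (auto simp: A_def B_def algebra_simps)
    have "fps_nth G n = (\<Sum>k\<le>n. fps_nth A (n - k) * \<zeta> ^ k)"
      unfolding G_def Z_def fps_mult_nth atLeast0AtMost by (simp add: mult.commute)
    also have "\<dots> = (\<Sum>k\<le>n. (if k = n then \<zeta> ^ n else 0) - cnj (taylor_coeff ?\<phi> (n - k)) * \<zeta> ^ k)"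
      by (rule sum.cong[OF refl]) (use A in simp)
    finally show ?thesis by (simp add: sum_subtractf sum.delta)
  qed
  have rec: "fps_nth G n = \<zeta> ^ n - (\<Sum>k<n. c (n - k) * fps_nth G k)" for n
  proof -
    have "G * C = Z" using AC by (simp add: G_def mult.assoc)
    then have "\<zeta> ^ n = (\<Sum>k\<le>n. fps_nth G k * c (n - k))"
      by (simp add: Z_def C_def fps_eq_iff fps_mult_nth atLeast0AtMost)
    also have "\<dots> = fps_nth G n + (\<Sum>k<n. c (n - k) * fps_nth G k)"
      by (simp add: lessThan_Suc_atMost[symmetric] c0 mult.commute)
    finally show ?thesis by simp
  qed
  have "kaczmarz_dual \<mu> (\<lambda>k \<omega>. \<omega> ^ k) n \<zeta> = fps_nth G n"
  proof (induction n rule: less_induct)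
    case (less n)
    have "kaczmarz_dual \<mu> (\<lambda>k \<omega>. \<omega> ^ k) n \<zeta> =
       \<zeta> ^ n - (\<Sum>k<n. l2_inner \<mu> (\<lambda>\<omega>. \<omega> ^ n) (\<lambda>\<omega>. \<omega> ^ k) * kaczmarz_dual \<mu> (\<lambda>k \<omega>. \<omega> ^ k) k \<zeta>)"
      by (rule kaczmarz_dual.simps)
    also have "\<dots> = fps_nth G n"
      unfolding rec[of n] using less by (simp add: moment)
    finally show ?case .
  qed
  then show ?thesis by (simp add: G)
qed

end

section \<open>Non-tangential boundary values\<close>

lemma cmod_cis_diff_le: "cmod (cis a - cis b) \<le> \<bar>a - b\<bar>"
proof -
  have "cis a - cis b = cis b * (exp (\<i> * complex_of_real (a - b)) - 1)"
    unfolding cis_conv_exp[symmetric] by (simp add: right_diff_distrib cis_mult)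
  then have "cmod (cis a - cis b) = 2 * \<bar>sin ((a - b) / 2)\<bar>"
    by (simp only: norm_mult norm_cis dist_exp_i_1)
  also have "\<dots> \<le> 2 * \<bar>(a - b) / 2\<bar>"
    by (intro mult_left_mono abs_sin_x_le_abs_x) auto
  finally show ?thesis by simp
qed

text \<open>
  The ball contains the arcs of length \<open>r\<close> on both sides of \<open>\<zeta>\<close>. At least one of them does not cross
  the point 1, where the parametrisation of the circle jumps.
\<close>

lemma circle_lebesgue_cball_ge:
  assumes \<zeta>: "cmod \<zeta> = 1" and r: "0 < r" "r \<le> 1"
  shows "ennreal (r / (2 * pi)) \<le> emeasure circle_lebesgue (cball \<zeta> r \<inter> sphere 0 1)"
proof -
  define t where "t = Arg2pi \<zeta>"
  have t: "0 \<le> t" "t < 2 * pi" "\<zeta> = cis t"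
    using Arg2pi[of \<zeta>] \<zeta> by (auto simp: t_def cis_conv_exp is_Arg_def)
  define a where "a = (if t \<le> pi then t else t - r)"
  have I: "{a..a + r} \<subseteq> {0..<2*pi} \<inter> {\<theta>. cis \<theta> \<in> cball \<zeta> r \<inter> sphere 0 1}"
  proof
    fix \<theta> assume \<theta>: "\<theta> \<in> {a..a + r}"
    then have "\<bar>t - \<theta>\<bar> \<le> r" using r by (auto simp: a_def split: if_splits)
    then have "cmod (\<zeta> - cis \<theta>) \<le> r" using cmod_cis_diff_le[of t \<theta>] t(3) by simp
    moreover have "\<theta> \<in> {0..<2*pi}"
      using \<theta> t r pi_gt3 by (auto simp: a_def split: if_splits)
    ultimately show "\<theta> \<in> {0..<2*pi} \<inter> {\<theta>. cis \<theta> \<in> cball \<zeta> r \<inter> sphere 0 1}"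
      by (auto simp: dist_norm)
  qed
  have X: "cball \<zeta> r \<inter> sphere 0 1 \<in> sets circle_borel"
    by (simp add: sets_restrict_space_iff)
  have m: "{\<theta>. cis \<theta> \<in> cball \<zeta> r \<inter> sphere 0 1} \<in> sets borel"
    using measurable_sets[OF measurable_cis_circle X] by (simp add: vimage_def)
  have "emeasure circle_lebesgue (cball \<zeta> r \<inter> sphere 0 1) =
      emeasure (uniform_measure lborel {0..<2*pi}) {\<theta>. cis \<theta> \<in> cball \<zeta> r \<inter> sphere 0 1}"
    unfolding circle_lebesgue_def
    using X measurable_cis_circle by (subst emeasure_distr) (auto simp: vimage_def)
  also have "\<dots> = emeasure lborel ({0..<2*pi} \<inter> {\<theta>. cis \<theta> \<in> cball \<zeta> r \<inter> sphere 0 1}) / emeasure lborel {0..<2*pi}"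
    by (rule emeasure_uniform_measure) (use m in auto)
  also have "\<dots> \<ge> emeasure lborel {a..a + r} / emeasure lborel {0..<2*pi}"
    by (intro divide_right_mono_ennreal emeasure_mono I) (use m in auto)
  also have "emeasure lborel {a..a + r} / emeasure lborel {0..<2*pi} = ennreal (r / (2 * pi))"
    using r by (simp add: divide_ennreal)
  finally show ?thesis .
qed

context finite_circle_measure
begin

lemma cball_circle_sets: "cball \<zeta> r \<inter> sphere 0 1 \<in> sets \<mu>"
  by (rule borel_imp_sets) simp

text \<open>
  Each point of \<open>E\<close> is the centre of a small ball inside \<open>U\<close> of radius \<open>s\<close> and \<open>\<mu>\<close>-measure below
  \<open>C * s\<close>. Among the balls shrunk by the factor 5, Vitali's lemma selects disjoint ones whose
  enlargements to the original size still cover \<open>E\<close>. The constant consists of this factor 5 and of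
  the normalisation \<open>2 * pi\<close> of Lebesgue measure, by which a shrunk ball has Lebesgue measure at
  least \<open>s / 5 / (2 * pi)\<close>.
\<close>

lemma low_density_set_emeasure_le:
  assumes U: "open U" "E \<subseteq> U" and E: "E \<subseteq> sphere 0 1" and C: "0 \<le> C"
    and freq: "\<And>\<zeta>. \<zeta> \<in> E \<Longrightarrow> \<exists>\<^sub>F r in at_right 0. measure \<mu> (cball \<zeta> r \<inter> sphere 0 1) < C * r"
  shows "\<exists>A\<in>sets \<mu>. E \<subseteq> A \<and> emeasure \<mu> A \<le> ennreal (10 * pi * C) * emeasure circle_lebesgue (U \<inter> sphere 0 1)"
proof -
  interpret m: finite_circle_measure circle_lebesgue by (rule finite_circle_measure_circle_lebesgue)
  have "\<exists>r. 0 < r \<and> r \<le> 1 \<and> cball \<zeta> r \<subseteq> U \<and> measure \<mu> (cball \<zeta> r \<inter> sphere 0 1) < C * r" if \<zeta>: "\<zeta> \<in> E" for \<zeta>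
  proof -
    obtain b where b: "0 < b" "cball \<zeta> b \<subseteq> U"
      using U \<zeta> open_contains_cball by blast
    have "eventually (\<lambda>r. r \<in> {0<..<min b 1}) (at_right 0)"
      by (rule eventually_at_right_real) (use b in simp)
    from frequently_eventually_frequently[OF freq[OF \<zeta>] this]
    obtain r where "measure \<mu> (cball \<zeta> r \<inter> sphere 0 1) < C * r" "r \<in> {0<..<min b 1}"
      by (auto dest: frequently_ex)
    moreover from this have "cball \<zeta> r \<subseteq> cball \<zeta> b" by auto
    ultimately show ?thesis using b by (intro exI[of _ r]) auto
  qed
  then obtain s where s: "\<And>\<zeta>. \<zeta> \<in> E \<Longrightarrow> 0 < s \<zeta> \<and> s \<zeta> \<le> 1 \<and> cball \<zeta> (s \<zeta>) \<subseteq> U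
      \<and> measure \<mu> (cball \<zeta> (s \<zeta>) \<inter> sphere 0 1) < C * s \<zeta>"
    by metis
  obtain D where D: "countable D" "D \<subseteq> E"
      "pairwise (\<lambda>i j. disjnt (cball i (s i / 5)) (cball j (s j / 5))) D"
      "E \<subseteq> (\<Union>i\<in>D. cball i (5 * (s i / 5)))"
  proof (rule Vitali_covering_lemma_cballs[where S = E and K = E and a = "\<lambda>x. x" and r = "\<lambda>x. s x / 5" and B = 1])
    show "E \<subseteq> (\<Union>i\<in>E. cball i (s i / 5))" using s by fastforce
    show "0 < s i / 5 \<and> s i / 5 \<le> 1" if "i \<in> E" for i using s[OF that] by auto
  qed
  \<comment> \<open>The selected balls are arranged in sequences, with empty sets at the indices outside \<open>act\<close>,
    which exist if \<open>D\<close> is finite.\<close>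
  define act where "act = to_nat_on D ` D"
  define b where "b = from_nat_into D"
  have b: "b n \<in> D" if "n \<in> act" for n
    using that D(1) by (auto simp: act_def b_def)
  have b_inj: "b i \<noteq> b j" if "i \<in> act" "j \<in> act" "i \<noteq> j" for i j
    using that D(1) by (auto simp: act_def b_def)
  define A where "A n = (if n \<in> act then cball (b n) (s (b n)) \<inter> sphere 0 1 else {})" for n
  define B where "B n = (if n \<in> act then cball (b n) (s (b n) / 5) \<inter> sphere 0 1 else {})" for n
  have A_sets: "range A \<subseteq> sets \<mu>" by (auto simp: A_def cball_circle_sets)
  have B_sets: "range B \<subseteq> sets circle_lebesgue" using m.cball_circle_sets by (auto simp: B_def)
  have disj: "disjoint_family B"
    unfolding disjoint_family_on_def
  proof (intro ballI impI)
    fix i j :: nat assume ij: "i \<noteq> j"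
    show "B i \<inter> B j = {}"
    proof (cases "i \<in> act \<and> j \<in> act")
      case True
      then have "disjnt (cball (b i) (s (b i) / 5)) (cball (b j) (s (b j) / 5))"
        using D(3) b b_inj[of i j] ij by (simp add: pairwise_def)
      then show ?thesis by (auto simp: B_def disjnt_def)
    qed (auto simp: B_def)
  qed
  have cover: "E \<subseteq> (\<Union>n. A n)"
  proof
    fix \<zeta> assume \<zeta>: "\<zeta> \<in> E"
    then obtain i where i: "i \<in> D" "\<zeta> \<in> cball i (s i)" using D(4) by auto
    then have "\<zeta> \<in> A (to_nat_on D i)"
      using \<zeta> E D(1) by (auto simp: A_def act_def b_def)
    then show "\<zeta> \<in> (\<Union>n. A n)" by blast
  qed
  have le: "emeasure \<mu> (A n) \<le> ennreal (10 * pi * C) * emeasure circle_lebesgue (B n)" for n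
  proof (cases "n \<in> act")
    case True
    then have bn: "b n \<in> E" using b D(2) by auto
    note sn = s[OF bn]
    have "emeasure \<mu> (A n) \<le> ennreal (C * s (b n))"
      using sn True by (simp add: A_def emeasure_eq_measure ennreal_leI less_imp_le)
    also have "C * s (b n) = 10 * pi * C * (s (b n) / 5 / (2 * pi))" by simp
    also have "ennreal \<dots> = ennreal (10 * pi * C) * ennreal (s (b n) / 5 / (2 * pi))"
      by (rule ennreal_mult) (use C sn in auto)
    also have "\<dots> \<le> ennreal (10 * pi * C) * emeasure circle_lebesgue (B n)"
    proof (rule mult_left_mono)
      show "ennreal (s (b n) / 5 / (2 * pi)) \<le> emeasure circle_lebesgue (B n)"
        using circle_lebesgue_cball_ge[of "b n" "s (b n) / 5"] sn True bn E by (auto simp: B_def)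
    qed simp
    finally show ?thesis .
  qed (simp add: A_def)
  have "emeasure \<mu> (\<Union>n. A n) \<le> (\<Sum>n. emeasure \<mu> (A n))"
    by (rule emeasure_subadditive_countably[OF A_sets])
  also have "\<dots> \<le> (\<Sum>n. ennreal (10 * pi * C) * emeasure circle_lebesgue (B n))"
    by (intro suminf_le le) auto
  also have "\<dots> = ennreal (10 * pi * C) * emeasure circle_lebesgue (\<Union>n. B n)"
    by (simp add: suminf_emeasure[OF B_sets disj])
  also have "\<dots> \<le> ennreal (10 * pi * C) * emeasure circle_lebesgue (U \<inter> sphere 0 1)"
  proof (intro mult_left_mono emeasure_mono)
    show "(\<Union>n. B n) \<subseteq> U \<inter> sphere 0 1"
    proof
      fix x assume "x \<in> (\<Union>n. B n)"
      then obtain n where n: "n \<in> act" "x \<in> cball (b n) (s (b n) / 5) \<inter> sphere 0 1"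
        by (auto simp: B_def split: if_splits)
      have "b n \<in> E" using b n D(2) by auto
      from s[OF this] have "cball (b n) (s (b n) / 5) \<subseteq> U"
        by (intro order_trans[OF subset_cball[of "s (b n) / 5" "s (b n)"]]) auto
      then show "x \<in> U \<inter> sphere 0 1" using n by blast
    qed
    show "U \<inter> sphere 0 1 \<in> sets circle_lebesgue"
      by (rule m.borel_imp_sets) (use U in auto)
  qed simp
  finally show ?thesis
    using cover A_sets by (intro bexI[of _ "\<Union>n. A n"]) auto
qed

text \<open>
  Points of finite lower density form a set \<open>E\<close> inside a Lebesgue null set. The latter has open
  neighbourhoods \<open>U\<close> of arbitrarily small Lebesgue measure, so the covering estimate makes \<open>E\<close> a
  \<open>\<mu>\<close>-null set. The integer bounds \<open>C\<close> leave only countably many exceptional sets.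
\<close>

lemma singular_measure_density_infinite:
  assumes sing: "mutually_singular \<mu> circle_lebesgue"
  shows "AE \<zeta> in \<mu>. \<forall>C::nat. \<forall>\<^sub>F r in at_right 0. real C * r \<le> measure \<mu> (cball \<zeta> r \<inter> sphere 0 1)"
  unfolding AE_all_countable
proof
  fix C :: nat
  interpret m: finite_circle_measure circle_lebesgue by (rule finite_circle_measure_circle_lebesgue)
  obtain A where A: "A \<in> sets \<mu>" "A \<in> sets circle_lebesgue" "emeasure \<mu> A = 0"
      "emeasure circle_lebesgue (sphere 0 1 - A) = 0"
    using sing by (auto simp: mutually_singular_def)
  have N: "sphere 0 1 - A \<in> sets circle_lebesgue"
    using sets.compl_sets[OF A(2)] by simp
  define E where "E = {\<zeta> \<in> sphere 0 1 - A. \<exists>\<^sub>F r in at_right 0. measure \<mu> (cball \<zeta> r \<inter> sphere 0 1) < real C * r}"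
  \<comment> \<open>Measurability of \<open>E\<close> is avoided: only measurable supersets are constructed.\<close>
  have "\<exists>Q\<in>sets \<mu>. E \<subseteq> Q \<and> emeasure \<mu> Q \<le> ennreal (10 * pi * real C) * ennreal (inverse (real (Suc k)))" for k
  proof -
    have "0 < ennreal (inverse (real (Suc k)))" by simp
    from m.open_outer_approximation_null[OF N A(4) this]
    obtain U where U: "open U" "sphere 0 1 - A \<subseteq> U" "emeasure circle_lebesgue (U \<inter> sphere 0 1) < ennreal (inverse (real (Suc k)))"
      by blast
    have "\<exists>Q\<in>sets \<mu>. E \<subseteq> Q \<and> emeasure \<mu> Q \<le> ennreal (10 * pi * real C) * emeasure circle_lebesgue (U \<inter> sphere 0 1)"
      by (rule low_density_set_emeasure_le[OF U(1)]) (use U(2) in \<open>auto simp: E_def\<close>)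
    then obtain Q where Q: "Q \<in> sets \<mu>" "E \<subseteq> Q" "emeasure \<mu> Q \<le> ennreal (10 * pi * real C) * emeasure circle_lebesgue (U \<inter> sphere 0 1)"
      by blast
    note Q(3)
    also have "ennreal (10 * pi * real C) * emeasure circle_lebesgue (U \<inter> sphere 0 1) \<le> ennreal (10 * pi * real C) * ennreal (inverse (real (Suc k)))"
      by (intro mult_left_mono less_imp_le[OF U(3)]) simp
    finally show ?thesis using Q by blast
  qed
  then obtain Q where Q: "\<And>k. Q k \<in> sets \<mu>" "\<And>k. E \<subseteq> Q k"
     "\<And>k. emeasure \<mu> (Q k) \<le> ennreal (10 * pi * real C) * ennreal (inverse (real (Suc k)))"
    by metis
  have lim: "(\<lambda>k. 10 * pi * real C * inverse (real (Suc k))) \<longlonglongrightarrow> 0"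
    using tendsto_mult_left[OF LIMSEQ_inverse_real_of_nat, of "10 * pi * real C"] by simp
  have QI: "(\<Inter>k. Q k) \<in> sets \<mu>" using Q(1) by auto
  have "measure \<mu> (\<Inter>k. Q k) \<le> 0"
  proof (rule tendsto_lowerbound[OF lim])
    show "\<forall>\<^sub>F k in sequentially. measure \<mu> (\<Inter>k. Q k) \<le> 10 * pi * real C * inverse (real (Suc k))"
    proof (intro always_eventually allI)
      fix k
      have "measure \<mu> (\<Inter>k. Q k) \<le> measure \<mu> (Q k)"
        by (rule finite_measure_mono) (use Q(1) in auto)
      also have "\<dots> \<le> 10 * pi * real C * inverse (real (Suc k))"
        using Q(3)[of k] by (simp add: emeasure_eq_measure ennreal_mult[symmetric] del: of_nat_Suc)
      finally show "measure \<mu> (\<Inter>k. Q k) \<le> 10 * pi * real C * inverse (real (Suc k))" .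
    qed
  qed simp
  then have "(\<Inter>k. Q k) \<in> null_sets \<mu>"
    using QI by (simp add: null_sets_def emeasure_eq_measure measure_le_0_iff)
  moreover have "A \<in> null_sets \<mu>" using A by (simp add: null_sets_def)
  ultimately have "A \<union> (\<Inter>k. Q k) \<in> null_sets \<mu>" by auto
  then show "AE \<zeta> in \<mu>. \<forall>\<^sub>F r in at_right 0. real C * r \<le> measure \<mu> (cball \<zeta> r \<inter> sphere 0 1)"
  proof (rule AE_I', intro subsetI)
    fix \<zeta> assume "\<zeta> \<in> {\<zeta> \<in> space \<mu>. \<not> (\<forall>\<^sub>F r in at_right 0. real C * r \<le> measure \<mu> (cball \<zeta> r \<inter> sphere 0 1))}"
    then have "\<zeta> \<in> A \<or> \<zeta> \<in> E"
      by (auto simp: E_def space_eq not_eventually not_le)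
    then show "\<zeta> \<in> A \<union> (\<Inter>k. Q k)" using Q(2) by blast
  qed
qed

text \<open>
  With \<open>\<rho> = 1 - \<bar>w\<bar>\<close>, a point \<open>w\<close> of the Stolz region is at distance at most \<open>(1 + \<alpha>) * \<rho>\<close> from every
  point of the ball of radius \<open>\<rho>\<close> around \<open>\<zeta>\<close>. So the Poisson kernel is at least
  \<open>1 / ((1 + \<alpha>)\<^sup>2 * \<rho>)\<close> on that ball.
\<close>

lemma Re_herglotz_stolz_ge:
  assumes w: "w \<in> stolz_region \<zeta> \<alpha>" and \<alpha>: "1 < \<alpha>"
  shows "measure \<mu> (cball \<zeta> (1 - cmod w) \<inter> sphere 0 1) / ((1 + \<alpha>)\<^sup>2 * (1 - cmod w)) \<le> Re (herglotz \<mu> w)"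
proof -
  define \<rho> where "\<rho> = 1 - cmod w"
  have w1: "cmod w < 1" and wz: "cmod (\<zeta> - w) < \<alpha> * \<rho>"
    using w by (auto simp: stolz_region_def \<rho>_def)
  have \<rho>: "0 < \<rho>" using w1 by (simp add: \<rho>_def)
  let ?X = "cball \<zeta> \<rho> \<inter> sphere 0 1"
  let ?P = "\<lambda>\<xi>. (1 - (cmod w)\<^sup>2) / (cmod (\<xi> - w))\<^sup>2"
  have P0: "\<rho> \<le> 1 - (cmod w)\<^sup>2"
    using w1 mult_left_le[of "cmod w" "cmod w"] by (simp add: \<rho>_def power2_eq_square)
  have P: "indicator ?X \<xi> *\<^sub>R (1 / ((1 + \<alpha>)\<^sup>2 * \<rho>)) \<le> ?P \<xi>" if \<xi>: "\<xi> \<in> space \<mu>" for \<xi>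
  proof (cases "\<xi> \<in> ?X")
    case True
    have "cmod (\<xi> - w) \<le> cmod (\<zeta> - \<xi>) + cmod (\<zeta> - w)"
      using norm_triangle_ineq4[of "\<zeta> - w" "\<zeta> - \<xi>"] by simp
    also have "\<dots> \<le> (1 + \<alpha>) * \<rho>" using True wz by (simp add: dist_norm distrib_right)
    finally have "(cmod (\<xi> - w))\<^sup>2 \<le> ((1 + \<alpha>) * \<rho>)\<^sup>2" by (rule power_mono) simp
    moreover have "0 < cmod (\<xi> - w)" using \<xi> w1 by (auto simp: space_eq)
    ultimately have "\<rho> / ((1 + \<alpha>) * \<rho>)\<^sup>2 \<le> ?P \<xi>"
      using P0 \<rho> by (intro frac_le) auto
    moreover have "\<rho> / ((1 + \<alpha>) * \<rho>)\<^sup>2 = 1 / ((1 + \<alpha>)\<^sup>2 * \<rho>)"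
      using \<rho> by (simp add: power2_eq_square)
    ultimately show ?thesis using True by simp
  next
    case False
    then show ?thesis using P0 \<rho> by simp
  qed
  have "measure \<mu> ?X / ((1 + \<alpha>)\<^sup>2 * \<rho>) = (LINT \<xi>|\<mu>. indicator ?X \<xi> *\<^sub>R (1 / ((1 + \<alpha>)\<^sup>2 * \<rho>)))"
    using cball_circle_sets[of \<zeta> \<rho>] by (simp add: space_eq Int_absorb2 Int_absorb1)
  also have "\<dots> \<le> (LINT \<xi>|\<mu>. ?P \<xi>)"
  proof (rule integral_mono[OF _ _ P])
    show "integrable \<mu> (\<lambda>\<xi>. indicator ?X \<xi> *\<^sub>R (1 / ((1 + \<alpha>)\<^sup>2 * \<rho>)))"
      by (intro integrable_mult_indicator cball_circle_sets) simp
    show "integrable \<mu> ?P"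
      by (intro integrable_continuous continuous_intros) (use w1 in auto)
  qed
  also have "\<dots> = Re (herglotz \<mu> w)" by (rule Re_herglotz[OF w1, symmetric])
  finally show ?thesis by (simp add: \<rho>_def)
qed

lemma inner_fun_of_nt_limit:
  assumes \<zeta>: "cmod \<zeta> = 1"
    and dens: "\<And>C::nat. \<forall>\<^sub>F r in at_right 0. real C * r \<le> measure \<mu> (cball \<zeta> r \<inter> sphere 0 1)"
  shows "has_nt_limit (inner_fun_of \<mu>) \<zeta> 1"
  unfolding has_nt_limit_def
proof (intro allI impI)
  fix \<alpha> :: real assume \<alpha>: "1 < \<alpha>"
  let ?F = "at \<zeta> within stolz_region \<zeta> \<alpha>"
  have in_stolz: "\<forall>\<^sub>F w in ?F. w \<in> stolz_region \<zeta> \<alpha>"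
    by (simp add: eventually_at_filter)
  have "filterlim (\<lambda>w. Re (herglotz \<mu> w)) at_top ?F"
    unfolding filterlim_at_top
  proof
    fix Z :: real
    obtain C :: nat where C: "Z * (1 + \<alpha>)\<^sup>2 \<le> real C" using real_arch_simple by blast
    obtain b where b: "0 < b" "\<And>r. 0 < r \<Longrightarrow> r < b \<Longrightarrow> real C * r \<le> measure \<mu> (cball \<zeta> r \<inter> sphere 0 1)"
      using dens[of C] by (auto simp: eventually_at_right_field)
    have "\<forall>\<^sub>F w in ?F. dist w \<zeta> < b"
      using b(1) by (auto simp: eventually_at)
    with in_stolz show "\<forall>\<^sub>F w in ?F. Z \<le> Re (herglotz \<mu> w)"
    proof eventually_elim
      case (elim w)
      define \<rho> where "\<rho> = 1 - cmod w"
      have \<rho>: "0 < \<rho>" using elim(1) by (simp add: stolz_region_def \<rho>_def)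
      have "\<rho> \<le> dist w \<zeta>"
        using norm_triangle_ineq2[of \<zeta> w] \<zeta> by (simp add: \<rho>_def dist_norm norm_minus_commute)
      with elim(2) have "\<rho> < b" by simp
      have "Z \<le> real C / (1 + \<alpha>)\<^sup>2" using C \<alpha> by (simp add: pos_le_divide_eq)
      also have "\<dots> = real C * \<rho> / ((1 + \<alpha>)\<^sup>2 * \<rho>)" using \<rho> by simp
      also have "\<dots> \<le> measure \<mu> (cball \<zeta> \<rho> \<inter> sphere 0 1) / ((1 + \<alpha>)\<^sup>2 * \<rho>)"
        using b(2)[OF \<rho> \<open>\<rho> < b\<close>] \<rho> by (intro divide_right_mono) auto
      also have "\<dots> \<le> Re (herglotz \<mu> w)"
        using Re_herglotz_stolz_ge[OF elim(1) \<alpha>] by (simp add: \<rho>_def)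
      finally show ?case .
    qed
  qed
  then have "filterlim (\<lambda>w. cmod (herglotz \<mu> w + 1)) at_top ?F"
  proof (rule filterlim_at_top_mono)
    show "\<forall>\<^sub>F w in ?F. Re (herglotz \<mu> w) \<le> cmod (herglotz \<mu> w + 1)"
    proof (rule always_eventually, rule allI)
      fix w
      show "Re (herglotz \<mu> w) \<le> cmod (herglotz \<mu> w + 1)"
        using complex_Re_le_cmod[of "herglotz \<mu> w + 1"] by simp
    qed
  qed
  then have "((\<lambda>w. 2 / (herglotz \<mu> w + 1)) \<longlongrightarrow> 0) ?F"
    by (intro tendsto_divide_0[OF tendsto_const] filterlim_norm_at_top_imp_at_infinity)
  then have "((\<lambda>w. 1 - 2 / (herglotz \<mu> w + 1)) \<longlongrightarrow> 1 - 0) ?F"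
    by (intro tendsto_intros)
  moreover have "\<forall>\<^sub>F w in ?F. 1 - 2 / (herglotz \<mu> w + 1) = inner_fun_of \<mu> w"
    using in_stolz
  proof eventually_elim
    case (elim w)
    then have "cmod w < 1" by (simp add: stolz_region_def)
    from one_minus_inner_fun_of[OF this, symmetric] show ?case by simp
  qed
  ultimately show "(inner_fun_of \<mu> \<longlongrightarrow> 1) ?F"
    by (simp add: tendsto_cong)
qed

end

theorem theorem3p1:
  fixes \<mu> :: "complex measure" and n :: nat
  assumes "prob_space \<mu>" and "sets \<mu> = sets circle_borel"
    and "mutually_singular \<mu> circle_lebesgue"
  shows "AE \<zeta> in \<mu>. has_nt_limit (model_proj (inner_fun_of \<mu>) (\<lambda>z. z ^ n)) \<zeta>
                      (kaczmarz_dual \<mu> (\<lambda>k \<omega>. \<omega> ^ k) n \<zeta>)"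
proof -
  interpret finite_circle_measure \<mu>
    by (intro finite_circle_measure.intro finite_circle_measure_axioms.intro
          prob_space.axioms(1)[OF assms(1)] assms(2))
  have mass: "measure \<mu> (space \<mu>) = 1" by (rule prob_space.prob_space[OF assms(1)])
  let ?\<phi> = "inner_fun_of \<mu>"
  let ?q = "\<lambda>z. \<Sum>k\<le>n. cnj (taylor_coeff ?\<phi> (n - k)) * z ^ k"
  have bd: "\<forall>z. cmod z < 1 \<longrightarrow> cmod (?\<phi> z) \<le> 1" using inner_fun_of_bounds(2) by blast
  have proj: "model_proj ?\<phi> (\<lambda>z. z ^ n) w = w ^ n - ?\<phi> w * ?q w" if "cmod w < 1" for w
    by (rule model_proj_power[OF inner_fun_of_holomorphic bd inner_fun_of_norm[OF assms(3)] that])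
  show ?thesis
    using singular_measure_density_infinite[OF assms(3)] AE_space
  proof eventually_elim
    case (elim \<zeta>)
    have \<zeta>: "cmod \<zeta> = 1" using elim(2) by (simp add: space_eq)
    show ?case
      unfolding has_nt_limit_def
    proof (intro allI impI)
      fix \<alpha> :: real assume \<alpha>: "1 < \<alpha>"
      let ?F = "at \<zeta> within stolz_region \<zeta> \<alpha>"
      have "(?\<phi> \<longlongrightarrow> 1) ?F"
        using inner_fun_of_nt_limit[OF \<zeta>] elim(1) \<alpha> by (simp add: has_nt_limit_def)
      then have "((\<lambda>w. w ^ n - ?\<phi> w * ?q w) \<longlongrightarrow> \<zeta> ^ n - 1 * ?q \<zeta>) ?F"
        by (intro tendsto_intros)
      moreover have "\<forall>\<^sub>F w in ?F. w ^ n - ?\<phi> w * ?q w = model_proj ?\<phi> (\<lambda>z. z ^ n) w"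
        using proj by (simp add: eventually_at_filter stolz_region_def)
      ultimately show "(model_proj ?\<phi> (\<lambda>z. z ^ n) \<longlongrightarrow> kaczmarz_dual \<mu> (\<lambda>k \<omega>. \<omega> ^ k) n \<zeta>) ?F"
        unfolding kaczmarz_dual_monomials[OF mass] by (simp add: tendsto_cong)
    qed
  qed
qed

end
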